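(* Let $G$ be a finitely generated recursively presented group. Then the subshift $X_{\leq 1}\subset\{0,1\}^G$ is effectively closed if and only if the word problem $\mathtt{WP}(G)$ is decidable.
   Context: Let $S\subset G$ be a finite generating set closed under inverses and containing $1_G$; words in $S^*$ represent elements of $G$, and $\mathtt{WP}(G)=\{w\in S^*: w=_G 1_G\}$, where $u=_G v$ means $u,v$ represent the same element. $G$ is recursively presented if it has a presentation $\langle S\mid R\rangle$ with $S$ finite and $R\subset S^*$ recursively enumerable. $X_{\leq 1}\subset\{0,1\}^G$ is the set of configurations $x:G\to\{0,1\}$ containing at most one occurrence of $1$, i.e. $x_g=x_h=1$ implies $g=h$. For a finite alphabet $A$, put $[a]_g=\{x\in A^G:x_g=a\}$. A pattern coding over $A$ is a finite set $c$ of pairs $(w,a)$ with $w\in S^*$, $a\in A$. For a set $\mathcal C$ of pattern codings, $X_{\mathcal C}=\bigcap_{g\in G,\,c\in\mathcal C}\big(A^G\setminus\bigcap_{(w,a)\in c}[a]_{gw}\big)$. $X\subset A^G$ is effectively closed if $X=X_{\mathcal C}$ for some recursively enumerable set $\mathcal C$ of pattern codings over $A$. *)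

theory Defs
  imports "HOL-Algebra.Generated_Groups" "HOL-Library.Nat_Bijection"
begin

section \<open>Computability on the natural numbers\<close>

text \<open>
  \<open>recursive_fun n f\<close>: \<open>f\<close>, restricted to argument lists of length \<open>n\<close>, is a total recursive
  (general recursive) \<open>n\<close>-ary function. All functions are total, since minimisation is only
  applied to regular functions. Values on lists of other lengths are irrelevant.
\<close>

inductive recursive_fun :: "nat \<Rightarrow> (nat list \<Rightarrow> nat) \<Rightarrow> bool" where
  zero: "recursive_fun n (\<lambda>_. 0)"
| succ: "recursive_fun 1 (\<lambda>xs. Suc (xs ! 0))"
| proj: "i < n \<Longrightarrow> recursive_fun n (\<lambda>xs. xs ! i)"
| comp: "recursive_fun (length gs) f \<Longrightarrow> \<forall>g\<in>set gs. recursive_fun n g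
    \<Longrightarrow> recursive_fun n (\<lambda>xs. f (map (\<lambda>g. g xs) gs))"
| prim_rec: "recursive_fun n f \<Longrightarrow> recursive_fun (Suc (Suc n)) g
    \<Longrightarrow> recursive_fun (Suc n)
          (\<lambda>xs. rec_nat (f (tl xs)) (\<lambda>y r. g (y # r # tl xs)) (hd xs))"
| minimise: "recursive_fun (Suc n) f \<Longrightarrow> \<forall>xs. length xs = n \<longrightarrow> (\<exists>y. f (y # xs) = 0)
    \<Longrightarrow> recursive_fun n (\<lambda>xs. LEAST y. f (y # xs) = 0)"

definition decidable_nat :: "nat set \<Rightarrow> bool" where
  "decidable_nat A \<longleftrightarrow>
     (\<exists>f. recursive_fun 1 f \<and> (\<forall>x. f [x] = (if x \<in> A then 1 else 0)))"

definition rec_enum_nat :: "nat set \<Rightarrow> bool" where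
  "rec_enum_nat A \<longleftrightarrow> A = {} \<or> (\<exists>f. recursive_fun 1 f \<and> A = range (\<lambda>x. f [x]))"


section \<open>Computability for words and pattern codings over finite alphabets\<close>

text \<open>
  Letters are numbered by an injection \<open>e\<close> into the natural numbers. For a finite alphabet the
  notions below do not depend on the numbering, as any two numberings differ by a
  finite (hence recursive) translation of letters.
\<close>

definition word_code :: "('s \<Rightarrow> nat) \<Rightarrow> 's list \<Rightarrow> nat" where
  "word_code e w = list_encode (map e w)"

definition decidable_words :: "'s set \<Rightarrow> 's list set \<Rightarrow> bool" where
  "decidable_words S L \<longleftrightarrow> (\<exists>e. inj_on e S \<and> decidable_nat (word_code e ` L))"

definition rec_enum_words :: "'s set \<Rightarrow> 's list set \<Rightarrow> bool" where
  "rec_enum_words S L \<longleftrightarrow> (\<exists>e. inj_on e S \<and> rec_enum_nat (word_code e ` L))"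

definition pattern_codings :: "'s set \<Rightarrow> 'b set \<Rightarrow> ('s list \<times> 'b) set set" where
  "pattern_codings S A = {c. finite c \<and> c \<subseteq> lists S \<times> A}"

definition coding_code :: "('s \<Rightarrow> nat) \<Rightarrow> ('b \<Rightarrow> nat) \<Rightarrow> ('s list \<times> 'b) set \<Rightarrow> nat" where
  "coding_code e d c = set_encode ((\<lambda>(w, a). prod_encode (word_code e w, d a)) ` c)"

definition rec_enum_codings :: "'s set \<Rightarrow> 'b set \<Rightarrow> ('s list \<times> 'b) set set \<Rightarrow> bool" where
  "rec_enum_codings S A C \<longleftrightarrow>
     (\<exists>e d. inj_on e S \<and> inj_on d A \<and> rec_enum_nat (coding_code e d ` C))"


section \<open>Words and presentations of groups\<close>

definition word_value :: "('a, 'm) monoid_scheme \<Rightarrow> 'a list \<Rightarrow> 'a" where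
  "word_value G w = foldr (\<otimes>\<^bsub>G\<^esub>) w \<one>\<^bsub>G\<^esub>"

definition word_problem :: "('a, 'm) monoid_scheme \<Rightarrow> 'a set \<Rightarrow> 'a list set" where
  "word_problem G S = {w \<in> lists S. word_value G w = \<one>\<^bsub>G\<^esub>}"

definition symmetric_generating_set :: "('a, 'm) monoid_scheme \<Rightarrow> 'a set \<Rightarrow> bool" where
  "symmetric_generating_set G S \<longleftrightarrow>
     S \<subseteq> carrier G \<and> generate G S = carrier G \<and> (\<forall>s\<in>S. inv\<^bsub>G\<^esub> s \<in> S) \<and> \<one>\<^bsub>G\<^esub> \<in> S"

text \<open>
  The group presented by generators \<open>S\<close> and relators \<open>R\<close> is the quotient of the free monoid on
  \<open>S \<times> UNIV\<close> by the congruence generated by free cancellation and by the relators.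
  The letter \<open>(s, True)\<close> stands for \<open>s\<close> and \<open>(s, False)\<close> for its formal inverse.
\<close>

inductive presented_eq :: "'s set \<Rightarrow> ('s \<times> bool) list set \<Rightarrow>
    ('s \<times> bool) list \<Rightarrow> ('s \<times> bool) list \<Rightarrow> bool"
  for S R where
  refl: "w \<in> lists (S \<times> UNIV) \<Longrightarrow> presented_eq S R w w"
| sym: "presented_eq S R u v \<Longrightarrow> presented_eq S R v u"
| trans: "presented_eq S R u v \<Longrightarrow> presented_eq S R v w \<Longrightarrow> presented_eq S R u w"
| append: "presented_eq S R u u' \<Longrightarrow> presented_eq S R v v' \<Longrightarrow> presented_eq S R (u @ v) (u' @ v')"
| cancel: "s \<in> S \<Longrightarrow> presented_eq S R [(s, b), (s, \<not> b)] []"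
| relator: "r \<in> R \<Longrightarrow> presented_eq S R r []"

definition presented_group :: "'s set \<Rightarrow> ('s \<times> bool) list set \<Rightarrow> ('s \<times> bool) list set monoid" where
  "presented_group S R =
     \<lparr>carrier = lists (S \<times> UNIV) // {(u, v). presented_eq S R u v},
      mult = (\<lambda>U V. \<Union>u\<in>U. \<Union>v\<in>V. {w. presented_eq S R (u @ v) w}),
      one = {w. presented_eq S R [] w}\<rparr>"

text \<open>
  The generators of a presentation are formal symbols, so natural numbers suffice as names for
  finitely many of them. Relators may contain formal inverses of generators, as is the
  case for words over an alphabet that is closed under inverses.
\<close>

definition recursively_presented :: "('a, 'm) monoid_scheme \<Rightarrow> bool" where
  "recursively_presented G \<longleftrightarrow>
     (\<exists>(T :: nat set) R. finite T \<and> R \<subseteq> lists (T \<times> UNIV) \<and> rec_enum_words (T \<times> UNIV) R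
        \<and> G \<cong> presented_group T R)"


section \<open>Effectively closed sets of configurations\<close>

definition configurations :: "('a, 'm) monoid_scheme \<Rightarrow> 'b set \<Rightarrow> ('a \<Rightarrow> 'b) set" where
  "configurations G A = (carrier G \<rightarrow>\<^sub>E A)"

definition cylinder :: "('a, 'm) monoid_scheme \<Rightarrow> 'b set \<Rightarrow> 'b \<Rightarrow> 'a \<Rightarrow> ('a \<Rightarrow> 'b) set" where
  "cylinder G A a g = {x \<in> configurations G A. x g = a}"

text \<open>
  The outer intersection with \<open>configurations G A\<close> only matters for empty \<open>C\<close>.
\<close>

definition avoiding :: "('a, 'm) monoid_scheme \<Rightarrow> 'b set \<Rightarrow> ('a list \<times> 'b) set set
    \<Rightarrow> ('a \<Rightarrow> 'b) set" where
  "avoiding G A C = configurations G A \<inter>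
     (\<Inter>g\<in>carrier G. \<Inter>c\<in>C.
        configurations G A - (\<Inter>(w, a)\<in>c. cylinder G A a (g \<otimes>\<^bsub>G\<^esub> word_value G w)))"

definition effectively_closed :: "('a, 'm) monoid_scheme \<Rightarrow> 'a set \<Rightarrow> 'b set
    \<Rightarrow> ('a \<Rightarrow> 'b) set \<Rightarrow> bool" where
  "effectively_closed G S A X \<longleftrightarrow>
     (\<exists>C \<subseteq> pattern_codings S A. rec_enum_codings S A C \<and> X = avoiding G A C)"

definition at_most_one_one :: "('a, 'm) monoid_scheme \<Rightarrow> ('a \<Rightarrow> nat) set" where
  "at_most_one_one G = {x \<in> configurations G {0, 1}.
     \<forall>g\<in>carrier G. \<forall>h\<in>carrier G. x g = 1 \<and> x h = 1 \<longrightarrow> g = h}"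

end

theory Submission
  imports Defs
begin

text \<open>
  Write \<open>WP\<close> for the set of words over \<open>S\<close> that represent \<open>\<one>\<close>.

  If \<open>WP\<close> is decidable, then the words outside \<open>WP\<close> can be enumerated, and forbidding a \<open>1\<close> at both
  ends of each of them, that is, forbidding the codings \<open>{([], 1), (w, 1)}\<close>, leaves exactly the
  configurations with at most one \<open>1\<close> (\<open>effectively_closed_if_decidable_word_problem\<close>).

  Conversely, let an enumerable set \<open>C\<close> of codings define the subshift. Deciding \<open>WP\<close> amounts to
  enumerating both \<open>WP\<close> and its complement (\<open>decidable_nat_if_semidecidable\<close>). A single forbidden
  coding is no certificate for \<open>w \<notin> WP\<close>: whether it is matched depends on which words have
  different values, and that is the question to be answered. The remedy is to pull
  configurations on \<open>G\<close> back to sets \<open>X\<close> of words over the generators of a recursive presentation.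
  Such a set comes from \<open>G\<close> if and only if it is invariant under inserting and deleting relators
  and words \<open>s s\<inverse>\<close>. Let \<open>p\<close> be a translation of \<open>w\<close> into these generators. Then

    \<^item> \<open>w \<in> WP\<close> if and only if no invariant \<open>X\<close> contains \<open>[]\<close> but not \<open>p\<close> (\<open>trivial_iff\<close>), and

    \<^item> \<open>w \<notin> WP\<close> if and only if no invariant \<open>X\<close> that avoids all translates of all codings in \<open>C\<close>
      contains both \<open>[]\<close> and \<open>p\<close> (\<open>nontrivial_iff\<close>).

  Both statements say that an enumerable list of finite conditions on \<open>X\<close> is unsatisfiable. By
  compactness (\<open>finitary_compactness\<close>) finitely many of the conditions are then unsatisfiable
  already, and this can be found by a search (\<open>semidecidable_refutable\<close>). The second statement
  is where the argument by cases over all \<open>X\<close> replaces the missing knowledge about \<open>G\<close>.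

  The computability part shows that these searches are recursive. Its two main tools are bounded
  quantification and folding over coded words.
\<close>

section \<open>Closure properties of the recursive functions\<close>

text \<open>
  Agreement is demanded on lists of length \<open>n\<close> only, so that the class, unlike
  \<open>recursive_fun n\<close> itself, is visibly closed under changing irrelevant values.
\<close>

definition computable :: "nat \<Rightarrow> (nat list \<Rightarrow> nat) \<Rightarrow> bool" where
  "computable n f \<longleftrightarrow> (\<exists>f'. recursive_fun n f' \<and> (\<forall>xs. length xs = n \<longrightarrow> f' xs = f xs))"

definition computable_pred :: "nat \<Rightarrow> (nat list \<Rightarrow> bool) \<Rightarrow> bool" where
  "computable_pred n P \<longleftrightarrow> computable n (\<lambda>xs. of_bool (P xs))"

text \<open>
  The rules collected here decompose the body of a function syntactically. A body with bound
  variables is treated as a function of a longer argument list: the innermost bound variable is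
  \<open>ys ! 0\<close>, and the previous arguments are \<open>drop 1 ys\<close>. Since argument lists are matched in this
  form only, projections from up to four nested \<open>drop\<close>s have to be recognised.
\<close>

named_theorems computable_rules

lemma computable_cong:
  assumes "computable n f" "\<And>xs. length xs = n \<Longrightarrow> f xs = g xs"
  shows "computable n g"
  using assms unfolding computable_def by fastforce

lemma computable_pred_cong:
  assumes "computable_pred n P" "\<And>xs. length xs = n \<Longrightarrow> P xs = Q xs"
  shows "computable_pred n Q"
  using assms unfolding computable_pred_def by (auto intro: computable_cong)

lemma recursive_fun_imp_computable: "recursive_fun n f \<Longrightarrow> computable n f"
  unfolding computable_def by auto

lemma computable_nth [computable_rules]: "i < n \<Longrightarrow> computable n (\<lambda>xs. xs ! i)"
  by (intro recursive_fun_imp_computable recursive_fun.proj)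

lemma computable_nth_drop [computable_rules]:
  "i + a < n \<Longrightarrow> computable n (\<lambda>xs. drop a xs ! i)"
  "i + a + b < n \<Longrightarrow> computable n (\<lambda>xs. drop a (drop b xs) ! i)"
  "i + a + b + c < n \<Longrightarrow> computable n (\<lambda>xs. drop a (drop b (drop c xs)) ! i)"
  "i + a + b + c + d < n \<Longrightarrow> computable n (\<lambda>xs. drop a (drop b (drop c (drop d xs))) ! i)"
  by (rule computable_cong[OF computable_nth], assumption, simp add: add.commute add.left_commute)+

lemma computable_comp:
  assumes f: "computable (length gs) f" and g: "\<forall>g\<in>set gs. computable n g"
  shows "computable n (\<lambda>xs. f (map (\<lambda>g. g xs) gs))"
proof -
  from g obtain r where r: "\<forall>g\<in>set gs. recursive_fun n (r g) \<and>
      (\<forall>xs. length xs = n \<longrightarrow> r g xs = g xs)"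
    unfolding computable_def by metis
  from f obtain f' where f': "recursive_fun (length gs) f'"
      "\<forall>xs. length xs = length gs \<longrightarrow> f' xs = f xs"
    unfolding computable_def by auto
  have "recursive_fun n (\<lambda>xs. f' (map (\<lambda>g. g xs) (map r gs)))"
    by (rule recursive_fun.comp) (use f' r in auto)
  moreover have "f' (map (\<lambda>g. g xs) (map r gs)) = f (map (\<lambda>g. g xs) gs)" if "length xs = n" for xs
  proof -
    have "map (\<lambda>g. g xs) (map r gs) = map (\<lambda>g. g xs) gs"
      using r that by auto
    moreover have "length (map (\<lambda>g. g xs) gs) = length gs" by simp
    ultimately show ?thesis using f' by metis
  qed
  ultimately show ?thesis unfolding computable_def by blast
qed

lemma computable_comp1:
  assumes "computable 1 (\<lambda>ys. f (ys ! 0))" "computable n A"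
  shows "computable n (\<lambda>xs. f (A xs))"
  using computable_comp[of "[A]" "\<lambda>ys. f (ys ! 0)" n] assms by simp

lemma computable_comp2:
  assumes "computable 2 (\<lambda>ys. f (ys ! 0) (ys ! 1))" "computable n A" "computable n B"
  shows "computable n (\<lambda>xs. f (A xs) (B xs))"
  using computable_comp[of "[A, B]" "\<lambda>ys. f (ys ! 0) (ys ! 1)" n] assms
  by (simp add: numeral_2_eq_2)

lemma computable_pred_comp1:
  assumes "computable_pred 1 (\<lambda>ys. P (ys ! 0))" "computable n A"
  shows "computable_pred n (\<lambda>xs. P (A xs))"
  using computable_comp1[of "\<lambda>x. of_bool (P x)"] assms by (simp add: computable_pred_def)

lemma computable_pred_comp2:
  assumes "computable_pred 2 (\<lambda>ys. P (ys ! 0) (ys ! 1))" "computable n A" "computable n B"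
  shows "computable_pred n (\<lambda>xs. P (A xs) (B xs))"
  using computable_comp2[of "\<lambda>x y. of_bool (P x y)"] assms by (simp add: computable_pred_def)

lemma computable_pred_comp3:
  assumes P: "computable_pred 3 (\<lambda>ys. P (ys ! 0) (ys ! 1) (ys ! 2))"
    and "computable n A" "computable n B" "computable n C"
  shows "computable_pred n (\<lambda>xs. P (A xs) (B xs) (C xs))"
proof -
  have [simp]: "[a, b, c] ! 2 = c" for a b c :: nat
    by (simp add: numeral_2_eq_2)
  show ?thesis
    using computable_comp[of "[A, B, C]" "\<lambda>ys. of_bool (P (ys ! 0) (ys ! 1) (ys ! 2))" n] assms
    by (simp add: computable_pred_def numeral_3_eq_3)
qed

lemma computable_Suc [computable_rules]:
  "computable n A \<Longrightarrow> computable n (\<lambda>xs. Suc (A xs))"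
  by (rule computable_comp1, rule recursive_fun_imp_computable, rule recursive_fun.succ)

lemma computable_const [computable_rules]: "computable n (\<lambda>_. c)"
  by (induction c)
     (auto intro: computable_Suc recursive_fun_imp_computable recursive_fun.zero)

text \<open>
  The workhorse for functions with parameters: the \<open>n\<close> parameters are passed on, while the \<open>m\<close>
  arguments in front of them are replaced by new ones.
\<close>

lemma computable_replace_front:
  assumes h: "computable (length gs + n) h" and gs: "\<forall>g\<in>set gs. computable (m + n) g"
  shows "computable (m + n) (\<lambda>xs. h (map (\<lambda>g. g xs) gs @ drop m xs))"
proof -
  let ?gs = "gs @ map (\<lambda>i xs. xs ! i) [m..<m + n]"
  have "computable (m + n) (\<lambda>xs. h (map (\<lambda>g. g xs) ?gs))"
    by (rule computable_comp) (use h gs in \<open>auto intro: computable_nth\<close>)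
  moreover have "map ((!) xs) [m..<length xs] = drop m xs" for xs :: "nat list"
    by (metis drop_map drop_upt map_nth plus_nat.add_0)
  then have "map ((!) xs) [m..<m + n] = drop m xs" if "length xs = m + n" for xs :: "nat list"
    using that by metis
  ultimately show ?thesis
    by (elim computable_cong) (simp add: comp_def)
qed

lemma computable_rec_nat [computable_rules]:
  assumes A: "computable n A" and N: "computable n N"
    and H: "computable (Suc (Suc n)) (\<lambda>zs. H (zs ! 0) (zs ! 1) (drop 2 zs))"
  shows "computable n (\<lambda>xs. rec_nat (A xs) (\<lambda>y r. H y r xs) (N xs))"
proof -
  from A obtain A' where A': "recursive_fun n A'" "\<forall>xs. length xs = n \<longrightarrow> A' xs = A xs"
    unfolding computable_def by auto
  from H obtain H' where H': "recursive_fun (Suc (Suc n)) H'"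
      "\<forall>zs. length zs = Suc (Suc n) \<longrightarrow> H' zs = H (zs ! 0) (zs ! 1) (drop 2 zs)"
    unfolding computable_def by auto
  have "computable (Suc n)
      (\<lambda>xs. rec_nat (A' (tl xs)) (\<lambda>y r. H' (y # r # tl xs)) (hd xs))"
    by (intro recursive_fun_imp_computable recursive_fun.prim_rec A' H')
  from computable_replace_front[of "[N]" n _ 0] this N
  have "computable n (\<lambda>xs. rec_nat (A' (tl (N xs # xs))) (\<lambda>y r. H' (y # r # tl (N xs # xs)))
      (hd (N xs # xs)))"
    by fastforce
  then show ?thesis
    by (rule computable_cong) (simp add: A' H')
qed

lemma computable_Least [computable_rules]:
  assumes P: "computable_pred (Suc n) (\<lambda>ys. P (ys ! 0) (drop 1 ys))"
    and ex: "\<And>xs. length xs = n \<Longrightarrow> \<exists>y. P y xs"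
  shows "computable n (\<lambda>xs. LEAST y. P y xs)"
proof -
  have "computable (Suc n) (\<lambda>ys. rec_nat 1 (\<lambda>_ _. 0) (of_bool (P (ys ! 0) (drop 1 ys))))"
    using P by (intro computable_rules) (simp add: computable_pred_def)
  then obtain f where f: "recursive_fun (Suc n) f"
      "\<forall>ys. length ys = Suc n \<longrightarrow> f ys = rec_nat 1 (\<lambda>_ _. 0) (of_bool (P (ys ! 0) (drop 1 ys)))"
    unfolding computable_def by auto
  have f0: "f (y # xs) = 0 \<longleftrightarrow> P y xs" if "length xs = n" for y xs
    using f(2) that by simp
  have "computable n (\<lambda>xs. LEAST y. f (y # xs) = 0)"
    by (intro recursive_fun_imp_computable recursive_fun.minimise f) (use f0 ex in auto)
  then show ?thesis
    by (rule computable_cong) (simp add: f0)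
qed

lemma computable_add [computable_rules]:
  assumes "computable n A" "computable n B"
  shows "computable n (\<lambda>xs. A xs + B xs)"
proof -
  have "computable n (\<lambda>xs. rec_nat (A xs) (\<lambda>_ r. Suc r) (B xs))"
    by (intro computable_rules assms) simp
  moreover have "rec_nat a (\<lambda>_ r. Suc r) b = a + b" for a b
    by (induction b) auto
  ultimately show ?thesis by simp
qed

lemma computable_mult [computable_rules]:
  assumes "computable n A" "computable n B"
  shows "computable n (\<lambda>xs. A xs * B xs)"
proof -
  have "computable 2 (\<lambda>xs. rec_nat 0 (\<lambda>_ r. r + xs ! 0) (xs ! 1))"
    by (intro computable_rules) simp_all
  moreover have "rec_nat 0 (\<lambda>_ r. r + a) b = a * b" for a b :: nat
    by (induction b) auto
  ultimately show ?thesis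
    by (intro computable_comp2[OF _ assms]) simp
qed

lemma computable_diff [computable_rules]:
  assumes "computable n A" "computable n B"
  shows "computable n (\<lambda>xs. A xs - B xs)"
proof -
  (* The inner recursion is the predecessor function. *)
  have "computable n (\<lambda>xs. rec_nat (A xs) (\<lambda>_ r. rec_nat 0 (\<lambda>y _. y) r) (B xs))"
    by (intro computable_rules assms) simp_all
  moreover have "rec_nat a (\<lambda>_ r. rec_nat 0 (\<lambda>y _. y) r) b = a - b" for a b :: nat
  proof (induction b)
    case (Suc b)
    have "rec_nat 0 (\<lambda>y _. y) r = r - 1" for r :: nat by (cases r) auto
    then show ?case using Suc by simp
  qed simp
  ultimately show ?thesis by simp
qed

lemma computable_power2 [computable_rules]:
  assumes "computable n A"
  shows "computable n (\<lambda>xs. 2 ^ A xs)"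
proof -
  have "computable n (\<lambda>xs. rec_nat 1 (\<lambda>_ r. r + r) (A xs))"
    by (intro computable_rules assms) simp_all
  moreover have "rec_nat 1 (\<lambda>_ r. r + r) b = (2 ^ b :: nat)" for b
    by (induction b) auto
  ultimately show ?thesis by simp
qed

lemma computable_pred_not [computable_rules]:
  assumes "computable_pred n P"
  shows "computable_pred n (\<lambda>xs. \<not> P xs)"
proof -
  have "computable n (\<lambda>xs. 1 - of_bool (P xs))"
    using assms by (intro computable_rules) (simp_all add: computable_pred_def)
  then show ?thesis
    unfolding computable_pred_def by (rule computable_cong) simp
qed

lemma computable_pred_conj [computable_rules]:
  assumes "computable_pred n P" "computable_pred n Q"
  shows "computable_pred n (\<lambda>xs. P xs \<and> Q xs)"
proof -
  have "computable n (\<lambda>xs. of_bool (P xs) * of_bool (Q xs))"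
    using assms by (intro computable_rules) (simp_all add: computable_pred_def)
  then show ?thesis
    unfolding computable_pred_def by (rule computable_cong) simp
qed

lemma computable_pred_disj [computable_rules]:
  assumes "computable_pred n P" "computable_pred n Q"
  shows "computable_pred n (\<lambda>xs. P xs \<or> Q xs)"
proof -
  have "computable_pred n (\<lambda>xs. \<not> (\<not> P xs \<and> \<not> Q xs))"
    by (intro computable_rules assms)
  then show ?thesis by simp
qed

lemma computable_pred_imp [computable_rules]:
  assumes "computable_pred n P" "computable_pred n Q"
  shows "computable_pred n (\<lambda>xs. P xs \<longrightarrow> Q xs)"
proof -
  have "computable_pred n (\<lambda>xs. \<not> P xs \<or> Q xs)"
    by (intro computable_rules assms)
  then show ?thesis by (rule computable_pred_cong) auto
qed

lemma computable_pred_iff [computable_rules]: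
  assumes "computable_pred n P" "computable_pred n Q"
  shows "computable_pred n (\<lambda>xs. P xs \<longleftrightarrow> Q xs)"
proof -
  have "computable_pred n (\<lambda>xs. (P xs \<longrightarrow> Q xs) \<and> (Q xs \<longrightarrow> P xs))"
    by (intro computable_rules assms)
  then show ?thesis by (rule computable_pred_cong) auto
qed

lemma computable_if [computable_rules]:
  assumes "computable_pred n P" "computable n A" "computable n B"
  shows "computable n (\<lambda>xs. if P xs then A xs else B xs)"
proof -
  have P: "computable n (\<lambda>xs. of_bool (P xs))"
    using assms(1) by (simp add: computable_pred_def)
  have "computable n (\<lambda>xs. of_bool (P xs) * A xs + (1 - of_bool (P xs)) * B xs)"
    by (intro computable_add computable_mult computable_diff computable_const P assms)
  then show ?thesis by (rule computable_cong) auto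
qed

lemma computable_pred_le [computable_rules]:
  assumes "computable n A" "computable n B"
  shows "computable_pred n (\<lambda>xs. A xs \<le> B xs)"
proof -
  have "computable n (\<lambda>xs. 1 - (A xs - B xs))"
    by (intro computable_rules assms)
  then show ?thesis
    unfolding computable_pred_def by (rule computable_cong) auto
qed

lemma computable_pred_less [computable_rules]:
  assumes "computable n A" "computable n B"
  shows "computable_pred n (\<lambda>xs. A xs < B xs)"
  using computable_pred_not[OF computable_pred_le[OF assms(2,1)]] by (simp add: not_le)

lemma computable_pred_eq [computable_rules]:
  assumes "computable n A" "computable n B"
  shows "computable_pred n (\<lambda>xs. A xs = B xs)"
proof -
  have "computable_pred n (\<lambda>xs. A xs \<le> B xs \<and> B xs \<le> A xs)"
    by (intro computable_rules assms)
  then show ?thesis by (rule computable_pred_cong) auto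
qed

lemma computable_pred_bex [computable_rules]:
  assumes N: "computable n N" and P: "computable_pred (Suc n) (\<lambda>ys. P (ys ! 0) (drop 1 ys))"
  shows "computable_pred n (\<lambda>xs. \<exists>y<N xs. P y xs)"
proof -
  have P': "computable_pred (Suc (Suc n)) (\<lambda>zs. P (zs ! 0) (drop 2 zs))"
  proof -
    let ?h = "\<lambda>ys. of_bool (P (ys ! 0) (drop 1 ys)) :: nat"
    have "computable (2 + n) (\<lambda>zs. ?h (map (\<lambda>g. g zs) [\<lambda>zs. zs ! 0] @ drop 2 zs))"
      by (rule computable_replace_front[of "[\<lambda>zs. zs ! 0]" n ?h 2])
         (use P in \<open>auto simp: computable_pred_def intro: computable_nth\<close>)
    then have "computable (Suc (Suc n)) (\<lambda>zs. ?h (map (\<lambda>g. g zs) [\<lambda>zs. zs ! 0] @ drop 2 zs))"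
      by (simp only: add_2_eq_Suc)
    then show ?thesis
      unfolding computable_pred_def by (rule computable_cong) simp
  qed
  have "computable n (\<lambda>xs. rec_nat 0 (\<lambda>y r. if P y xs then 1 else r) (N xs))"
    by (intro computable_rules N P') simp_all
  moreover have "rec_nat 0 (\<lambda>y r. if P y xs then 1 else r) b = (of_bool (\<exists>y<b. P y xs) :: nat)"
    for b xs
  proof (induction b)
    case (Suc b)
    have "(\<exists>y<Suc b. P y xs) \<longleftrightarrow> P b xs \<or> (\<exists>y<b. P y xs)"
      using less_Suc_eq by metis
    then show ?case using Suc by simp
  qed simp
  ultimately show ?thesis
    unfolding computable_pred_def by (elim computable_cong) simp
qed

lemma computable_pred_ball [computable_rules]:
  assumes "computable n N" "computable_pred (Suc n) (\<lambda>ys. P (ys ! 0) (drop 1 ys))"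
  shows "computable_pred n (\<lambda>xs. \<forall>y<N xs. P y xs)"
proof -
  have "computable_pred n (\<lambda>xs. \<not> (\<exists>y<N xs. \<not> P y xs))"
    by (intro computable_rules assms)
  then show ?thesis by simp
qed

lemma computable_pred_const [computable_rules]: "computable_pred n (\<lambda>_. b)"
  unfolding computable_pred_def by (rule computable_const)

section \<open>Recursive functions on coded pairs, sets and words\<close>

lemma computable_prod_encode [computable_rules]:
  assumes "computable n A" "computable n B"
  shows "computable n (\<lambda>xs. prod_encode (A xs, B xs))"
proof -
  have "computable n (\<lambda>xs. rec_nat 0 (\<lambda>y r. r + Suc y) (A xs + B xs) + A xs)"
    by (intro computable_rules assms) simp_all
  moreover have "rec_nat 0 (\<lambda>y r. r + Suc y) m = triangle m" for m
    by (induction m) auto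
  ultimately show ?thesis by (simp add: prod_encode_def)
qed

lemma fst_prod_decode_eq_Least: "fst (prod_decode z) = (LEAST x. \<exists>y<Suc z. prod_encode (x, y) = z)"
proof (rule Least_equality[symmetric])
  show "\<exists>y<Suc z. prod_encode (fst (prod_decode z), y) = z"
    by (rule exI[of _ "snd (prod_decode z)"])
       (metis le_imp_less_Suc le_prod_encode_2 prod.collapse prod_decode_inverse)
qed (metis fst_conv order_refl prod_encode_inverse)

lemma snd_prod_decode_eq_Least: "snd (prod_decode z) = (LEAST y. \<exists>x<Suc z. prod_encode (x, y) = z)"
proof (rule Least_equality[symmetric])
  show "\<exists>x<Suc z. prod_encode (x, snd (prod_decode z)) = z"
    by (rule exI[of _ "fst (prod_decode z)"])
       (metis le_imp_less_Suc le_prod_encode_1 prod.collapse prod_decode_inverse)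
qed (metis snd_conv order_refl prod_encode_inverse)

lemma computable_fst_prod_decode [computable_rules]:
  assumes "computable n A"
  shows "computable n (\<lambda>xs. fst (prod_decode (A xs)))"
proof -
  have "computable 1 (\<lambda>xs. LEAST x. \<exists>y<Suc (xs ! 0). prod_encode (x, y) = xs ! 0)"
  proof (intro computable_rules)
    fix xs :: "nat list"
    show "\<exists>x. \<exists>y<Suc (xs ! 0). prod_encode (x, y) = xs ! 0"
      by (rule exI[of _ "fst (prod_decode (xs ! 0))"], rule exI[of _ "snd (prod_decode (xs ! 0))"])
         (metis le_imp_less_Suc le_prod_encode_2 prod.collapse prod_decode_inverse)
  qed simp_all
  then show ?thesis
    unfolding fst_prod_decode_eq_Least by (rule computable_comp1) (fact assms)
qed

lemma computable_snd_prod_decode [computable_rules]: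
  assumes "computable n A"
  shows "computable n (\<lambda>xs. snd (prod_decode (A xs)))"
proof -
  have "computable 1 (\<lambda>xs. LEAST y. \<exists>x<Suc (xs ! 0). prod_encode (x, y) = xs ! 0)"
  proof (intro computable_rules)
    fix xs :: "nat list"
    show "\<exists>y. \<exists>x<Suc (xs ! 0). prod_encode (x, y) = xs ! 0"
      by (rule exI[of _ "snd (prod_decode (xs ! 0))"], rule exI[of _ "fst (prod_decode (xs ! 0))"])
         (metis le_imp_less_Suc le_prod_encode_1 prod.collapse prod_decode_inverse)
  qed simp_all
  then show ?thesis
    unfolding snd_prod_decode_eq_Least by (rule computable_comp1) (fact assms)
qed

text \<open>
  Bit \<open>a\<close> of \<open>x\<close> is set if and only if the quotient of \<open>x\<close> by \<open>2 ^ a\<close> is odd. Naming quotient and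
  remainder turns this into a bounded search that needs no division.
\<close>

lemma mem_set_decode_iff:
  "a \<in> set_decode x \<longleftrightarrow> (\<exists>q<Suc x. \<exists>r<2 ^ a. x = (2 * q + 1) * 2 ^ a + r)"
proof
  assume "a \<in> set_decode x"
  then have odd: "odd (x div 2 ^ a)" by (simp add: set_decode_def)
  let ?q = "x div 2 ^ a div 2" and ?r = "x mod 2 ^ a"
  have "2 * ?q + 1 = x div 2 ^ a"
    using odd by simp
  then have "x = (2 * ?q + 1) * 2 ^ a + ?r"
    by (simp only: div_mult_mod_eq)
  moreover have "?q < Suc x"
    by (meson div_le_dividend le_imp_less_Suc order_trans)
  ultimately show "\<exists>q<Suc x. \<exists>r<2 ^ a. x = (2 * q + 1) * 2 ^ a + r"
    by (metis mod_less_divisor zero_less_numeral zero_less_power)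
next
  assume "\<exists>q<Suc x. \<exists>r<2 ^ a. x = (2 * q + 1) * 2 ^ a + r"
  then obtain q r where "r < 2 ^ a" "x = (2 * q + 1) * 2 ^ a + r" by blast
  then have "x div 2 ^ a = 2 * q + 1"
    by (simp only: div_mult_self3) simp
  then show "a \<in> set_decode x" by (simp add: set_decode_def)
qed

lemma computable_pred_mem_set_decode [computable_rules]:
  assumes "computable n A" "computable n X"
  shows "computable_pred n (\<lambda>xs. A xs \<in> set_decode (X xs))"
proof -
  have "computable_pred 2 (\<lambda>xs. \<exists>q<Suc (xs ! 1). \<exists>r<2 ^ (xs ! 0). xs ! 1 = (2 * q + 1) * 2 ^ (xs ! 0) + r)"
    by (intro computable_rules) simp_all
  then have "computable_pred 2 (\<lambda>xs. xs ! 0 \<in> set_decode (xs ! 1))"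
    by (simp only: mem_set_decode_iff)
  then show ?thesis
    by (rule computable_pred_comp2) (fact assms)+
qed

lemma length_list_decode_le: "length (list_decode l) \<le> l"
proof (induction l rule: list_decode.induct)
  case (2 n)
  obtain x y where xy: "prod_decode n = (x, y)" by fastforce
  then have "y \<le> n" by (metis le_prod_encode_2 prod_decode_inverse)
  then show ?case using 2[OF xy[symmetric]] xy by simp
qed simp

text \<open>
  A word is consumed letter by letter by iterating a step on the pair of the unread rest and the
  accumulator. The step does nothing once the rest is empty, so the code itself, which bounds the
  length of the word, is a sufficient number of iterations.
\<close>

lemma computable_fold [computable_rules]:
  assumes L: "computable n L" and A: "computable n A"
    and H: "computable (Suc (Suc n)) (\<lambda>zs. H (zs ! 0) (zs ! 1) (drop 2 zs))"
  shows "computable n (\<lambda>xs. fold (\<lambda>a r. H a r xs) (list_decode (L xs)) (A xs))"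
proof -
  define step where "step s xs = (if fst (prod_decode s) = 0 then s else
     prod_encode (snd (prod_decode (fst (prod_decode s) - 1)),
       H (fst (prod_decode (fst (prod_decode s) - 1))) (snd (prod_decode s)) xs))" for s xs
  have step: "step (prod_encode (list_encode us, r)) xs =
      prod_encode (list_encode (tl us), (if us = [] then r else H (hd us) r xs))" for us r xs
    by (cases us) (auto simp: step_def)
  have run: "rec_nat (prod_encode (list_encode us, r)) (\<lambda>_ s. step s xs) k
      = prod_encode (list_encode (drop k us), fold (\<lambda>a r. H a r xs) (take k us) r)" for us r xs k
  proof (induction k)
    case (Suc k)
    show ?case
    proof (cases "k < length us")
      case True
      then have "drop k us \<noteq> []" "hd (drop k us) = us ! k" "tl (drop k us) = drop (Suc k) us"
        by (auto simp: hd_drop_conv_nth drop_Suc tl_drop)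
      then show ?thesis using True Suc by (simp add: step take_Suc_conv_app_nth)
    qed (use Suc step[of "[]"] in simp)
  qed simp
  have H': "computable (Suc (Suc n)) (\<lambda>zs. step (zs ! 1) (drop 2 zs))"
  proof -
    let ?l = "\<lambda>zs :: nat list. fst (prod_decode (zs ! 1)) - 1"
    have l: "computable (Suc (Suc n)) (\<lambda>zs. fst (prod_decode (?l zs)))"
      "computable (Suc (Suc n)) (\<lambda>zs. snd (prod_decode (zs ! 1)))"
      by (intro computable_rules, simp)+
    have *: "computable (Suc (Suc n))
        (\<lambda>zs. H (fst (prod_decode (?l zs))) (snd (prod_decode (zs ! 1))) (drop 2 zs))"
    proof -
      let ?h = "\<lambda>zs. H (zs ! 0) (zs ! 1) (drop 2 zs)"
      let ?gs = "[\<lambda>zs. fst (prod_decode (?l zs)), \<lambda>zs. snd (prod_decode (zs ! 1))]"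
      have "computable (2 + n) (\<lambda>zs. ?h (map (\<lambda>g. g zs) ?gs @ drop 2 zs))"
        by (rule computable_replace_front[of ?gs n ?h 2]) (use H l in auto)
      then have "computable (Suc (Suc n)) (\<lambda>zs. ?h (map (\<lambda>g. g zs) ?gs @ drop 2 zs))"
        by (simp only: add_2_eq_Suc)
      then show ?thesis by (rule computable_cong) (simp add: numeral_2_eq_2)
    qed
    show ?thesis
      unfolding step_def by (intro computable_rules *) simp_all
  qed
  have "computable n (\<lambda>xs. snd (prod_decode
      (rec_nat (prod_encode (L xs, A xs)) (\<lambda>_ s. step s xs) (L xs))))"
    by (intro computable_rules L A H')
  moreover have "rec_nat (prod_encode (l, r)) (\<lambda>_ s. step s xs) l
      = prod_encode (0, fold (\<lambda>a r. H a r xs) (list_decode l) r)" for l r xs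
    using run[of "list_decode l" r xs l] length_list_decode_le[of l] by simp
  ultimately show ?thesis by simp
qed

lemma list_encode_rev: "list_encode (rev us) = fold (\<lambda>a r. Suc (prod_encode (a, r))) us 0"
proof -
  have "list_encode (rev us @ vs) = fold (\<lambda>a r. Suc (prod_encode (a, r))) us (list_encode vs)" for vs
  proof (induction us arbitrary: vs)
    case (Cons a us)
    from Cons[of "a # vs"] show ?case by simp
  qed simp
  from this[of "[]"] show ?thesis by simp
qed

text \<open>Words are folded from the left but built from the right, so the first factor is reversed.\<close>

lemma list_encode_append:
  "list_encode (us @ vs) = fold (\<lambda>a r. Suc (prod_encode (a, r))) (rev us) (list_encode vs)"
  unfolding foldr_conv_fold[symmetric] by (induction us) auto

definition append_code :: "nat \<Rightarrow> nat \<Rightarrow> nat" where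
  "append_code u v = list_encode (list_decode u @ list_decode v)"

lemma computable_append_code [computable_rules]:
  assumes "computable n A" "computable n B"
  shows "computable n (\<lambda>xs. append_code (A xs) (B xs))"
proof -
  let ?c = "\<lambda>a r. Suc (prod_encode (a, r))"
  have "computable n (\<lambda>xs. fold ?c (list_decode (fold ?c (list_decode (A xs)) 0)) (B xs))"
    by (intro computable_rules assms) simp_all
  then show ?thesis
    by (simp add: append_code_def list_encode_append flip: list_encode_rev)
qed

text \<open>
  This is how the finiteness of alphabets is used: a translation of finitely many letters is
  recursive no matter how it was chosen.
\<close>

lemma computable_finite_table:
  assumes "finite F"
  shows "computable 1 (\<lambda>xs. if xs ! 0 \<in> F then t (xs ! 0) else 0)"
  using assms
proof (induction F)
  case (insert a F)
  have "computable 1 (\<lambda>xs. if xs ! 0 = a then t a else if xs ! 0 \<in> F then t (xs ! 0) else 0)"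
    by (intro computable_rules insert) simp_all
  then show ?case by (rule computable_cong) auto
qed (simp add: computable_const)

lemma computable_pred_mem_finite [computable_rules]:
  assumes "finite F" "computable n A"
  shows "computable_pred n (\<lambda>xs. A xs \<in> F)"
proof -
  have "computable_pred 1 (\<lambda>xs. xs ! 0 \<in> F)"
    using computable_finite_table[OF assms(1), of "\<lambda>_. 1"]
    unfolding computable_pred_def by (rule computable_cong) simp
  then show ?thesis by (rule computable_pred_comp1) fact
qed

lemma computable_pred_word_over:
  assumes "finite F" "computable n A"
  shows "computable_pred n (\<lambda>xs. list_decode (A xs) \<in> lists F)"
proof -
  have "computable_pred 1
      (\<lambda>xs. fold (\<lambda>a r. if a \<in> F then r else 0) (list_decode (xs ! 0)) (Suc 0) = Suc 0)"
    by (intro computable_rules assms(1)) simp_all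
  moreover have "fold (\<lambda>a r. if a \<in> F then r else 0) us (r :: nat) = (if us \<in> lists F then r else 0)"
    for us r
    by (induction us arbitrary: r) (auto split: if_splits)
  ultimately have "computable_pred 1 (\<lambda>xs. list_decode (xs ! 0) \<in> lists F)"
    by (elim computable_pred_cong) simp
  then show ?thesis by (rule computable_pred_comp1) fact
qed

text \<open>The action on codes of the monoid homomorphism that is given by \<open>t\<close> on letters.\<close>

definition substitute_code :: "(nat \<Rightarrow> nat list) \<Rightarrow> nat \<Rightarrow> nat" where
  "substitute_code t k = list_encode (concat (map t (list_decode k)))"

lemma computable_substitute_code:
  assumes F: "finite F" "\<And>a. a \<notin> F \<Longrightarrow> t a = []" and A: "computable n A"
  shows "computable n (\<lambda>xs. substitute_code t (A xs))"
proof -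
  have "computable 1 (\<lambda>xs. if xs ! 0 \<in> F then list_encode (t (xs ! 0)) else 0)"
    by (rule computable_finite_table) fact
  then have letter: "computable 1 (\<lambda>xs. list_encode (t (xs ! 0)))"
    by (rule computable_cong) (auto simp: F(2))
  have "computable n (\<lambda>xs. fold (\<lambda>a r. append_code r (list_encode (t a))) (list_decode (A xs)) 0)"
    by (intro computable_rules A computable_comp1[OF letter]) simp_all
  moreover have "fold (\<lambda>a r. append_code r (list_encode (t a))) us (list_encode vs)
      = list_encode (vs @ concat (map t us))" for us vs
    by (induction us arbitrary: vs) (simp_all add: append_code_def)
  from this[of _ "[]"] have "fold (\<lambda>a r. append_code r (list_encode (t a))) us 0
      = list_encode (concat (map t us))" for us
    by simp
  ultimately show ?thesis by (simp add: substitute_code_def)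
qed

section \<open>Decidable and semidecidable sets\<close>

lemma decidable_nat_iff: "decidable_nat A \<longleftrightarrow> computable_pred 1 (\<lambda>xs. xs ! 0 \<in> A)"
proof
  assume "decidable_nat A"
  then obtain f where f: "recursive_fun 1 f" "\<And>x. f [x] = (if x \<in> A then 1 else 0)"
    unfolding decidable_nat_def by auto
  have "f xs = of_bool (xs ! 0 \<in> A)" if "length xs = 1" for xs
    using that f(2) by (cases xs) auto
  then show "computable_pred 1 (\<lambda>xs. xs ! 0 \<in> A)"
    using f(1) unfolding computable_pred_def computable_def by blast
next
  assume "computable_pred 1 (\<lambda>xs. xs ! 0 \<in> A)"
  then obtain f where "recursive_fun 1 f" "\<forall>xs. length xs = 1 \<longrightarrow> f xs = of_bool (xs ! 0 \<in> A)"
    unfolding computable_pred_def computable_def by blast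
  then show "decidable_nat A"
    unfolding decidable_nat_def by (intro exI[of _ f]) simp
qed

definition semidecidable_nat :: "nat set \<Rightarrow> bool" where
  "semidecidable_nat A \<longleftrightarrow>
     (\<exists>P. computable_pred 2 (\<lambda>xs. P (xs ! 0) (xs ! 1)) \<and> A = {x. \<exists>i. P x i})"

lemma rec_enum_nat_imp_semidecidable:
  assumes "rec_enum_nat A"
  shows "semidecidable_nat A"
proof (cases "A = {}")
  case True
  then show ?thesis
    unfolding semidecidable_nat_def
    by (intro exI[of _ "\<lambda>_ _. False"]) (simp add: computable_pred_const)
next
  case False
  then obtain f where f: "recursive_fun 1 f" "A = range (\<lambda>x. f [x])"
    using assms unfolding rec_enum_nat_def by auto
  have *: "computable 1 (\<lambda>xs. f [xs ! 0])"
    by (rule computable_cong[OF recursive_fun_imp_computable[OF f(1)]])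
       (metis One_nat_def length_0_conv length_Suc_conv nth_Cons_0)
  have "computable_pred 2 (\<lambda>xs. f [xs ! 1] = xs ! 0)"
    by (intro computable_rules computable_comp1[of "\<lambda>x. f [x]", OF *]) simp_all
  then show ?thesis
    unfolding semidecidable_nat_def using f(2) by (intro exI[of _ "\<lambda>x i. f [i] = x"]) auto
qed

lemma semidecidable_nat_Un_finite:
  assumes "semidecidable_nat A" "finite F"
  shows "semidecidable_nat (A \<union> F)"
proof -
  obtain P where P: "computable_pred 2 (\<lambda>xs. P (xs ! 0) (xs ! 1))" "A = {x. \<exists>i. P x i}"
    using assms(1) unfolding semidecidable_nat_def by auto
  have "computable_pred 2 (\<lambda>xs. P (xs ! 0) (xs ! 1) \<or> xs ! 0 \<in> F)"
    by (intro computable_rules P(1) assms(2)) simp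
  then show ?thesis
    unfolding semidecidable_nat_def using P(2)
    by (intro exI[of _ "\<lambda>x i. P x i \<or> x \<in> F"]) auto
qed

lemma rec_enum_nat_image:
  assumes P: "computable_pred 1 (\<lambda>xs. P (xs ! 0))" and f: "computable 1 (\<lambda>xs. f (xs ! 0))"
  shows "rec_enum_nat (f ` {x. P x})"
proof (cases "\<exists>x. P x")
  case True
  then obtain x0 where x0: "P x0" by auto
  have "computable 1 (\<lambda>xs. if P (xs ! 0) then f (xs ! 0) else f x0)"
    by (intro computable_rules P f)
  then obtain h where h: "recursive_fun 1 h"
      "\<forall>xs. length xs = 1 \<longrightarrow> h xs = (if P (xs ! 0) then f (xs ! 0) else f x0)"
    unfolding computable_def by auto
  have "f ` {x. P x} = range (\<lambda>x. h [x])"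
    using x0 h(2) by (auto simp: image_iff)
  then show ?thesis unfolding rec_enum_nat_def using h(1) by blast
qed (simp add: rec_enum_nat_def)

text \<open>
  Post's theorem: exactly one of the two searches succeeds, so the joint search always halts.
\<close>

lemma decidable_nat_if_semidecidable:
  assumes "semidecidable_nat A" "semidecidable_nat (- A)"
  shows "decidable_nat A"
proof -
  obtain P where P: "computable_pred 2 (\<lambda>xs. P (xs ! 0) (xs ! 1))" "A = {x. \<exists>i. P x i}"
    using assms(1) unfolding semidecidable_nat_def by auto
  obtain N where N: "computable_pred 2 (\<lambda>xs. N (xs ! 0) (xs ! 1))" "- A = {x. \<exists>i. N x i}"
    using assms(2) unfolding semidecidable_nat_def by auto
  have halts: "\<exists>i. P x i \<or> N x i" for x
    using P(2) N(2) by blast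
  have "computable_pred 1 (\<lambda>xs. P (xs ! 0) (LEAST i. P (xs ! 0) i \<or> N (xs ! 0) i))"
    by (intro computable_pred_comp2[OF P(1)] computable_pred_comp2[OF N(1)] computable_rules halts)
       simp_all
  moreover have "P x (LEAST i. P x i \<or> N x i) \<longleftrightarrow> x \<in> A" for x
    using LeastI_ex[OF halts[of x]] P(2) N(2) by blast
  ultimately show ?thesis by (simp add: decidable_nat_iff)
qed

section \<open>Compactness\<close>

text \<open>
  \<open>M n X\<close> is meant to say that \<open>X\<close> is refuted at stage \<open>n\<close>, that is, by inspecting
  only the elements of \<open>X\<close> below \<open>n\<close>.
\<close>

definition finitary :: "(nat \<Rightarrow> nat set \<Rightarrow> bool) \<Rightarrow> bool" where
  "finitary M \<longleftrightarrow>
     (\<forall>n X Y. X \<inter> {..<n} = Y \<inter> {..<n} \<longrightarrow> M n X = M n Y) \<and>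
     (\<forall>n m X. n \<le> m \<longrightarrow> M n X \<longrightarrow> M m X)"

lemma finitary_disj:
  assumes "finitary M" "finitary N"
  shows "finitary (\<lambda>n X. M n X \<or> N n X)"
  using assms unfolding finitary_def by meson

lemma finitary_mem: "finitary (\<lambda>n X. k < n \<and> k \<in> X)"
  and finitary_not_mem: "finitary (\<lambda>n X. k < n \<and> k \<notin> X)"
  unfolding finitary_def by auto

text \<open>
  If no single stage refutes every set, then Koenig's lemma yields a set that no stage refutes: its
  part below \<open>n\<close> is chosen so that, for every \<open>m\<close>, some extension survives stage \<open>m\<close>.
\<close>

lemma finitary_compactness:
  assumes M: "finitary M"
  shows "(\<forall>X. \<exists>n. M n X) \<longleftrightarrow> (\<exists>n. \<forall>x<2 ^ n. M n (set_decode x))"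
proof
  assume "\<exists>n. \<forall>x<2 ^ n. M n (set_decode x)"
  then obtain n where n: "\<And>x. x < 2 ^ n \<Longrightarrow> M n (set_decode x)" by auto
  have "M n X" for X
  proof -
    have "set_encode (X \<inter> {..<n}) < 2 ^ n"
    proof -
      have "set_encode (X \<inter> {..<n}) \<le> set_encode {..<n}"
        unfolding set_encode_def by (rule sum_mono2) auto
      also have "\<dots> < 2 ^ n"
        by (simp add: set_encode_def lessThan_atLeast0 sum_power2)
      finally show ?thesis .
    qed
    from n[OF this] have "M n (X \<inter> {..<n})" by simp
    (* Stage n cannot distinguish X from its part below n. *)
    then show ?thesis using M unfolding finitary_def by (metis inf.right_idem)
  qed
  then show "\<forall>X. \<exists>n. M n X" by blast
next
  assume refuted: "\<forall>X. \<exists>n. M n X"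
  show "\<exists>n. \<forall>x<2 ^ n. M n (set_decode x)"
  proof (rule ccontr)
    assume "\<not> ?thesis"
    then have survivor: "\<exists>X. \<not> M n X" for n by blast
    define good where "good n P \<longleftrightarrow> (\<forall>m. \<exists>X. X \<inter> {..<n} = P \<and> \<not> M m X)" for n P
    have good0: "good 0 {}"
      using survivor by (simp add: good_def)
    have step: "\<exists>P'. good (Suc n) P' \<and> P' \<inter> {..<n} = P" if P: "good n P" for n P
    proof (rule ccontr)
      assume none: "\<not> ?thesis"
      have sub: "P \<inter> {..<n} = P"
        using P unfolding good_def by blast
      moreover from sub have "insert n P \<inter> {..<n} = P" by auto
      ultimately have bad: "\<not> good (Suc n) P" "\<not> good (Suc n) (insert n P)"
        using none sub by metis+
      from bad(1) obtain m where m: "\<And>X. X \<inter> {..<Suc n} = P \<Longrightarrow> M m X"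
        unfolding good_def by metis
      from bad(2) obtain m' where m': "\<And>X. X \<inter> {..<Suc n} = insert n P \<Longrightarrow> M m' X"
        unfolding good_def by metis
      obtain X where X: "X \<inter> {..<n} = P" "\<not> M (max m m') X"
        using P unfolding good_def by metis
      have "X \<inter> {..<Suc n} = P \<or> X \<inter> {..<Suc n} = insert n P"
        using X(1) by (cases "n \<in> X") (auto simp: lessThan_Suc)
      with m m' have "M m X \<or> M m' X" by blast
      then have "M (max m m') X"
        using M unfolding finitary_def by (meson max.cobounded1 max.cobounded2)
      with X(2) show False by simp
    qed
    have "\<exists>P. \<forall>n. good n (P n) \<and> P (Suc n) \<inter> {..<n} = P n"
      by (rule dependent_nat_choice) (use good0 step in blast)+
    then obtain P where "\<forall>n. good n (P n) \<and> P (Suc n) \<inter> {..<n} = P n" ..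
    then have P: "good n (P n)" "P (Suc n) \<inter> {..<n} = P n" for n
      by simp_all
    define X where "X = {k. k \<in> P (Suc k)}"
    have below: "P n \<inter> {..<n} = P n" for n
      using P(2)[of n] by blast
    have coherent: "k \<in> P (Suc (k + d)) \<longleftrightarrow> k \<in> P (Suc k)" for k d
    proof (induction d)
      case (Suc d)
      have "k \<in> P (Suc (Suc (k + d))) \<longleftrightarrow> k \<in> P (Suc (k + d))"
        using P(2)[of "Suc (k + d)"] by (metis Int_iff le_add1 le_imp_less_Suc lessThan_iff)
      then show ?case using Suc by simp
    qed simp
    have "X \<inter> {..<n} = P n" for n
    proof -
      have "k \<in> P n \<longleftrightarrow> k \<in> P (Suc k)" if "k < n" for k
        using coherent[of k "n - Suc k"] that by simp
      then have "X \<inter> {..<n} = P n \<inter> {..<n}"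
        unfolding X_def by blast
      then show ?thesis by (simp only: below)
    qed
    then have "\<not> M n X" for n
      using P(1)[of n] M unfolding good_def finitary_def by metis
    with refuted show False by blast
  qed
qed

text \<open>
  Refuting all sets is a priori a condition on uncountably many of them. By compactness a single
  stage suffices, which sees only the \<open>2 ^ n\<close> subsets of \<open>{..<n}\<close>.
\<close>

lemma semidecidable_refutable:
  assumes "\<And>k. finitary (M k)"
    and "computable_pred 3 (\<lambda>xs. M (xs ! 0) (xs ! 1) (set_decode (xs ! 2)))"
  shows "semidecidable_nat {k. \<forall>X. \<exists>n. M k n X}"
proof -
  have "computable_pred 2 (\<lambda>xs. \<forall>x<2 ^ (xs ! 1). M (xs ! 0) (xs ! 1) (set_decode x))"
    by (rule computable_pred_ball computable_power2 computable_nth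
        computable_pred_comp3[of "\<lambda>k n x. M k n (set_decode x)", OF assms(2)] computable_nth_drop | simp)+
  moreover have "{k. \<forall>X. \<exists>n. M k n X} = {k. \<exists>n. \<forall>x<2 ^ n. M k n (set_decode x)}"
    using finitary_compactness[OF assms(1)] by (intro Collect_cong)
  ultimately show ?thesis
    unfolding semidecidable_nat_def by (intro exI[of _ "\<lambda>k n. \<forall>x<2 ^ n. M k n (set_decode x)"] conjI)
qed

section \<open>Group presentations over natural-number letters\<close>

lemma (in group) word_value_closed:
  "set u \<subseteq> carrier G \<Longrightarrow> word_value G u \<in> carrier G"
  by (induction u) (auto simp: word_value_def)

lemma (in group) word_value_append:
  assumes "set u \<subseteq> carrier G" "set v \<subseteq> carrier G"
  shows "word_value G (u @ v) = word_value G u \<otimes> word_value G v"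
  using assms(1)
proof (induction u)
  case Nil
  show ?case using word_value_closed[OF assms(2)] by (simp add: word_value_def)
next
  case (Cons a u)
  then show ?case
    using word_value_closed[OF assms(2)] word_value_closed[of u]
    by (simp add: word_value_def m_assoc)
qed

lemma (in group) generate_imp_word_value:
  assumes S: "S \<subseteq> carrier G" "\<forall>s\<in>S. inv s \<in> S" and g: "g \<in> generate G S"
  shows "\<exists>w\<in>lists S. word_value G w = g"
  using g
proof (induction rule: generate.induct)
  case one
  show ?case by (rule bexI[of _ "[]"]) (auto simp: word_value_def)
next
  case (incl h)
  then show ?case using S(1) by (intro bexI[of _ "[h]"]) (auto simp: word_value_def)
next
  case (inv h)
  then show ?case using S by (intro bexI[of _ "[inv h]"]) (auto simp: word_value_def)
next
  case (eng g h)
  then obtain u v where "u \<in> lists S" "word_value G u = g" "v \<in> lists S" "word_value G v = h"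
    by blast
  then show ?case
    using S(1) by (intro bexI[of _ "u @ v"]) (auto simp: word_value_append subset_iff)
qed

lemma avoiding_iff:
  "x \<in> avoiding G A C \<longleftrightarrow> x \<in> configurations G A \<and>
    \<not> (\<exists>g\<in>carrier G. \<exists>c\<in>C. \<forall>(w, a)\<in>c. x (g \<otimes>\<^bsub>G\<^esub> word_value G w) = a)"
proof (cases "x \<in> configurations G A")
  case True
  then have "x \<in> cylinder G A a h \<longleftrightarrow> x h = a" for a h
    by (simp add: cylinder_def)
  then show ?thesis
    using True by (simp add: avoiding_def case_prod_beta)
qed (simp add: avoiding_def)

definition insertion_invariant :: "'s list set \<Rightarrow> 's list set \<Rightarrow> bool" where
  "insertion_invariant Q X \<longleftrightarrow> (\<forall>q\<in>Q. \<forall>a b. a @ q @ b \<in> X \<longleftrightarrow> a @ b \<in> X)"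

text \<open>
  A presentation in the form in which it can be searched. Letters are natural numbers; \<open>K\<close> is the
  alphabet, and \<open>Q\<close> is thought of as the relators together with the words \<open>s s\<inverse>\<close>. The last axiom
  says that words of equal value are connected by insertions and deletions of elements of \<open>Q\<close>,
  in terms of sets that are closed under these moves because such sets are what the search is
  about. Numbers outside \<open>K\<close> also denote group elements, so that every number codes a word that
  has a value and a search need not recognise words over \<open>K\<close>.
\<close>

locale coded_presentation = group G for G (structure) +
  fixes L :: "nat \<Rightarrow> 'a" and K :: "nat set" and Q :: "nat list set"
  assumes letter_closed: "L n \<in> carrier G"
    and represents: "g \<in> carrier G \<Longrightarrow> \<exists>u\<in>lists K. word_value G (map L u) = g"
    and relation: "q \<in> Q \<Longrightarrow> word_value G (map L q) = \<one>"
    and complete: "\<lbrakk>u \<in> lists K; v \<in> lists K; word_value G (map L u) = word_value G (map L v);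
        insertion_invariant Q X\<rbrakk> \<Longrightarrow> u \<in> X \<longleftrightarrow> v \<in> X"
begin

definition val :: "nat list \<Rightarrow> 'a" where
  "val u = word_value G (map L u)"

lemma val_closed [simp]: "val u \<in> carrier G"
  unfolding val_def by (rule word_value_closed) (auto simp: letter_closed)

lemma val_append [simp]: "val (u @ v) = val u \<otimes> val v"
  by (simp add: val_def word_value_append letter_closed image_subset_iff)

lemma val_Nil [simp]: "val [] = \<one>"
  by (simp add: val_def word_value_def)

lemmas complete_val = complete[folded val_def]

lemma insertion_invariant_val: "insertion_invariant Q {u. val u \<in> Y}"
  using relation by (simp add: insertion_invariant_def flip: val_def)

text \<open>
  The words of value \<open>\<one>\<close> form an insertion invariant set that contains \<open>[]\<close>, and as far as words
  over \<open>K\<close> are concerned it is the least one.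
\<close>

lemma trivial_iff:
  assumes "p \<in> lists K"
  shows "val p = \<one> \<longleftrightarrow> (\<forall>X. insertion_invariant Q X \<and> [] \<in> X \<longrightarrow> p \<in> X)"
proof
  assume "val p = \<one>"
  then show "\<forall>X. insertion_invariant Q X \<and> [] \<in> X \<longrightarrow> p \<in> X"
    using complete_val[OF assms, of "[]"] by simp
next
  assume "\<forall>X. insertion_invariant Q X \<and> [] \<in> X \<longrightarrow> p \<in> X"
  then have "p \<in> {u. val u \<in> {\<one>}}"
    using insertion_invariant_val[of "{\<one>}"] by (metis (mono_tags, lifting) mem_Collect_eq singleton_iff val_Nil)
  then show "val p = \<one>" by simp
qed

lemma val_concat_map:
  assumes "w \<in> lists S" "\<And>s. s \<in> S \<Longrightarrow> val (t s) = s"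
  shows "val (concat (map t w)) = word_value G w"
  using assms(1)
proof (induction w)
  case (Cons s w)
  then show ?case using assms(2)[of s] by (simp add: word_value_def[of G "_ # _"] flip: word_value_def)
qed (simp add: word_value_def)

lemma concat_map_in_lists:
  assumes "w \<in> lists S" "\<And>s. s \<in> S \<Longrightarrow> t s \<in> lists K"
  shows "concat (map t w) \<in> lists K"
  using assms by (induction w) auto

text \<open>
  For a set \<open>X\<close> that is insertion invariant, membership of a word over \<open>K\<close> depends only on its
  value, so \<open>X\<close> induces a configuration on \<open>G\<close>. If \<open>X\<close> contains \<open>[]\<close> and \<open>p\<close> and avoids all
  translates of the codings, then this configuration has at most one \<open>1\<close>, but a \<open>1\<close> both at \<open>\<one>\<close>
  and at \<open>val p\<close>, so \<open>val p = \<one>\<close>. Conversely, if \<open>val p = \<one>\<close>, then the words of value \<open>\<one>\<close> form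
  such a set \<open>X\<close>, because the configuration with its only \<open>1\<close> at \<open>\<one>\<close> avoids \<open>C\<close>.
\<close>

lemma nontrivial_iff:
  assumes p: "p \<in> lists K" and S: "S \<subseteq> carrier G"
    and C: "C \<subseteq> pattern_codings S {0, 1}" "at_most_one_one G = avoiding G {0, 1} C"
    and t: "\<And>s. s \<in> S \<Longrightarrow> t s \<in> lists K" "\<And>s. s \<in> S \<Longrightarrow> val (t s) = s"
  shows "val p \<noteq> \<one> \<longleftrightarrow> (\<forall>X. insertion_invariant Q X \<and> [] \<in> X \<and> p \<in> X \<longrightarrow>
    (\<exists>g. \<exists>c\<in>C. \<forall>(w, a)\<in>c. g @ concat (map t w) \<in> X \<longleftrightarrow> a = 1))"
proof
  assume nontrivial: "val p \<noteq> \<one>"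
  show "\<forall>X. insertion_invariant Q X \<and> [] \<in> X \<and> p \<in> X \<longrightarrow>
    (\<exists>g. \<exists>c\<in>C. \<forall>(w, a)\<in>c. g @ concat (map t w) \<in> X \<longleftrightarrow> a = 1)"
  proof (intro allI impI, elim conjE)
    fix X assume X: "insertion_invariant Q X" "[] \<in> X" "p \<in> X"
    define x where "x = (\<lambda>h\<in>carrier G. if \<exists>u\<in>lists K. val u = h \<and> u \<in> X then 1 else 0 :: nat)"
    have x_val: "x (val u) = (if u \<in> X then 1 else 0)" if "u \<in> lists K" for u
    proof -
      have "(\<exists>v\<in>lists K. val v = val u \<and> v \<in> X) \<longleftrightarrow> u \<in> X"
        using complete_val[OF _ that _ X(1)] that by metis
      then show ?thesis by (simp add: x_def)
    qed
    have conf: "x \<in> configurations G {0, 1}"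
      by (auto simp: x_def configurations_def)
    have "x (val []) = 1" "x (val p) = 1"
      using x_val[of "[]"] x_val[OF p] X by simp_all
    then have "x \<notin> at_most_one_one G"
      using nontrivial val_closed[of p] val_closed[of "[]"]
      unfolding at_most_one_one_def val_Nil by blast
    then have "\<exists>h\<in>carrier G. \<exists>c\<in>C. \<forall>(w, a)\<in>c. x (h \<otimes> word_value G w) = a"
      using conf unfolding C(2) avoiding_iff by blast
    then obtain h c where h: "h \<in> carrier G" and c: "c \<in> C"
      and "\<forall>(w, a)\<in>c. x (h \<otimes> word_value G w) = a"
      by blast
    then have match: "x (h \<otimes> word_value G w) = a" if "(w, a) \<in> c" for w a
      using that by fastforce
    obtain g where g: "g \<in> lists K" "val g = h"
      using represents[OF h] unfolding val_def by blast
    have "g @ concat (map t w) \<in> X \<longleftrightarrow> a = 1" if wa: "(w, a) \<in> c" for w a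
    proof -
      have w: "w \<in> lists S" and a: "a \<in> {0, 1}"
        using C(1) c wa unfolding pattern_codings_def by blast+
      have "x (val (g @ concat (map t w))) = a"
        using match[OF wa] val_concat_map[OF w t(2)] g(2) by simp
      moreover have "g @ concat (map t w) \<in> lists K"
        using g(1) concat_map_in_lists[OF w t(1)] by simp
      ultimately have "a = (if g @ concat (map t w) \<in> X then 1 else 0)"
        using x_val by metis
      then show ?thesis by simp
    qed
    then show "\<exists>g. \<exists>c\<in>C. \<forall>(w, a)\<in>c. g @ concat (map t w) \<in> X \<longleftrightarrow> a = 1"
      using c by blast
  qed
next
  assume refuted: "\<forall>X. insertion_invariant Q X \<and> [] \<in> X \<and> p \<in> X \<longrightarrow>
    (\<exists>g. \<exists>c\<in>C. \<forall>(w, a)\<in>c. g @ concat (map t w) \<in> X \<longleftrightarrow> a = 1)"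
  show "val p \<noteq> \<one>"
  proof
    assume "val p = \<one>"
    then have "\<exists>g. \<exists>c\<in>C. \<forall>(w, a)\<in>c. g @ concat (map t w) \<in> {u. val u \<in> {\<one>}} \<longleftrightarrow> a = 1"
      by (intro refuted[rule_format] conjI insertion_invariant_val) simp_all
    then obtain g c where c: "c \<in> C"
      and "\<forall>(w, a)\<in>c. g @ concat (map t w) \<in> {u. val u \<in> {\<one>}} \<longleftrightarrow> a = 1"
      by blast
    then have match: "val g \<otimes> val (concat (map t w)) = \<one> \<longleftrightarrow> a = 1" if "(w, a) \<in> c" for w a
      using that by fastforce
    define x where "x = (\<lambda>h\<in>carrier G. if h = \<one> then 1 else 0 :: nat)"
    have conf: "x \<in> configurations G {0, 1}"
      by (auto simp: x_def configurations_def)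
    have "x \<in> at_most_one_one G"
      using conf by (auto simp: x_def at_most_one_one_def)
    then have "x \<in> avoiding G {0, 1} C" using C(2) by simp
    moreover have "x (val g \<otimes> word_value G w) = a" if wa: "(w, a) \<in> c" for w a
    proof -
      have w: "w \<in> lists S" and a: "a \<in> {0, 1}"
        using C(1) c wa unfolding pattern_codings_def by blast+
      have "word_value G w \<in> carrier G"
        using w S by (intro word_value_closed) auto
      then have "val g \<otimes> word_value G w \<in> carrier G" by simp
      moreover have "val g \<otimes> word_value G w = \<one> \<longleftrightarrow> a = 1"
        using match[OF wa] val_concat_map[OF w t(2)] by simp
      ultimately show ?thesis
        using a by (auto simp: x_def)
    qed
    ultimately show False
      using c val_closed[of g] unfolding avoiding_iff by blast
  qed
qed

end

text \<open>
  The surrounding words \<open>a\<close> and \<open>c\<close> make the statement strong enough for induction: they absorb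
  the other factor when two equations are concatenated.
\<close>

lemma presented_eq_imp_insertion_invariant:
  assumes "presented_eq T R u v"
    and "insertion_invariant (R \<union> {[(s, b), (s, \<not> b)] |s b. s \<in> T}) X"
  shows "a @ u @ c \<in> X \<longleftrightarrow> a @ v @ c \<in> X"
  using assms(1)
proof (induction arbitrary: a c rule: presented_eq.induct)
  case (append u u' v v')
  from append.IH(1)[of a "v @ c"] append.IH(2)[of "a @ u'" c] show ?case by simp
next
  case (cancel s b)
  have "[(s, b), (s, \<not> b)] \<in> R \<union> {[(s, b), (s, \<not> b)] |s b. s \<in> T}"
    using cancel by blast
  from assms(2)[unfolded insertion_invariant_def, rule_format, OF this, of a c] show ?case by simp
next
  case (relator r)
  then show ?case using assms(2) unfolding insertion_invariant_def by simp
qed auto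

text \<open>
  \<open>\<phi>\<close> sends a word to the element of \<open>G\<close> that corresponds to its class. That \<open>\<phi> []\<close> is the unit
  follows by cancellation in \<open>G\<close>, since \<open>\<phi> []\<close> is idempotent.
\<close>

lemma presented_group_classes:
  fixes G (structure) and T :: "'s set"
  assumes "group G" and iso: "G \<cong> presented_group T R"
  shows "\<exists>\<phi>. \<phi> ` lists (T \<times> UNIV) = carrier G \<and> \<phi> [] = \<one> \<and>
    (\<forall>u\<in>lists (T \<times> UNIV). \<forall>v\<in>lists (T \<times> UNIV).
      \<phi> (u @ v) = \<phi> u \<otimes> \<phi> v \<and> (\<phi> u = \<phi> v \<longleftrightarrow> presented_eq T R u v))"
proof -
  interpret group G by fact
  let ?W = "lists (T \<times> UNIV) :: ('s \<times> bool) list set"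
  define cl where "cl u = {v. presented_eq T R u v}" for u
  have carrier: "carrier (presented_group T R) = cl ` ?W"
    unfolding presented_group_def cl_def by (auto simp: quotient_def)
  have cl_eq: "cl u = cl v \<longleftrightarrow> presented_eq T R u v" if "v \<in> ?W" for u v
  proof
    assume "cl u = cl v"
    then have "v \<in> cl u" using presented_eq.refl[OF that] by (simp add: cl_def)
    then show "presented_eq T R u v" by (simp add: cl_def)
  qed (auto simp: cl_def intro: presented_eq.sym presented_eq.trans)
  have cl_mult: "cl u \<otimes>\<^bsub>presented_group T R\<^esub> cl v = cl (u @ v)" if "u \<in> ?W" "v \<in> ?W" for u v
  proof -
    have "presented_eq T R (u @ v) w"
      if "presented_eq T R u u'" "presented_eq T R v v'" "presented_eq T R (u' @ v') w" for u' v' w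
      using presented_eq.trans[OF presented_eq.append[OF that(1,2)] that(3)] .
    moreover have "u \<in> cl u" "v \<in> cl v"
      using that by (auto simp: cl_def intro: presented_eq.refl)
    ultimately have "(\<Union>u'\<in>cl u. \<Union>v'\<in>cl v. cl (u' @ v')) = cl (u @ v)"
      unfolding cl_def by blast
    then show ?thesis
      unfolding presented_group_def cl_def by simp
  qed
  obtain h where h: "h \<in> iso G (presented_group T R)"
    using iso unfolding is_iso_def by blast
  then have hom: "\<And>x y. x \<in> carrier G \<Longrightarrow> y \<in> carrier G \<Longrightarrow>
      h (x \<otimes> y) = h x \<otimes>\<^bsub>presented_group T R\<^esub> h y"
    and bij: "bij_betw h (carrier G) (cl ` ?W)"
    unfolding iso_def hom_def carrier by auto
  define \<phi> where "\<phi> u = the_inv_into (carrier G) h (cl u)" for u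
  have inj: "inj_on h (carrier G)" and im: "h ` carrier G = cl ` ?W"
    using bij by (auto simp: bij_betw_def)
  have h_phi: "h (\<phi> u) = cl u" and phi_closed: "\<phi> u \<in> carrier G" if "u \<in> ?W" for u
  proof -
    have u: "cl u \<in> h ` carrier G" using that im by blast
    show "h (\<phi> u) = cl u" unfolding \<phi>_def by (rule f_the_inv_into_f[OF inj u])
    show "\<phi> u \<in> carrier G" unfolding \<phi>_def by (rule the_inv_into_into[OF inj u order_refl])
  qed
  have surj: "\<exists>u\<in>?W. \<phi> u = g" if "g \<in> carrier G" for g
  proof -
    have "h g \<in> cl ` ?W" using im that by blast
    then obtain u where "u \<in> ?W" "h g = cl u" by blast
    then show ?thesis
      using that inj by (intro bexI[of _ u]) (auto simp: \<phi>_def the_inv_into_f_eq)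
  qed
  have eq: "\<phi> u = \<phi> v \<longleftrightarrow> presented_eq T R u v" if "u \<in> ?W" "v \<in> ?W" for u v
    using inj_on_eq_iff[OF inj phi_closed[OF that(1)] phi_closed[OF that(2)]]
    by (simp only: h_phi[OF that(1)] h_phi[OF that(2)] cl_eq[OF that(2)])
  have mult: "\<phi> (u @ v) = \<phi> u \<otimes> \<phi> v" if "u \<in> ?W" "v \<in> ?W" for u v
  proof -
    have uv: "u @ v \<in> ?W" using that by simp
    have "h (\<phi> (u @ v)) = h (\<phi> u \<otimes> \<phi> v)"
      using that uv by (simp only: h_phi hom phi_closed cl_mult)
    then show ?thesis
      using inj_on_eq_iff[OF inj] phi_closed that uv by (meson m_closed)
  qed
  have "\<phi> [] = \<one>"
    using mult[of "[]" "[]"] phi_closed[of "[]"] by simp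
  moreover have "\<phi> ` ?W = carrier G"
    using phi_closed surj by blast
  ultimately show ?thesis
    by (intro exI[of _ \<phi>] conjI ballI mult eq)
qed

text \<open>
  The letters are named by the numbering with respect to which the relators are enumerable. There
  are only finitely many words \<open>s s\<inverse>\<close>, so adding them preserves semidecidability.
\<close>

lemma recursively_presented_imp_coded_presentation:
  fixes G (structure)
  assumes "group G" "recursively_presented G"
  obtains L K Q where "coded_presentation G L K Q" "semidecidable_nat (list_encode ` Q)"
proof -
  interpret group G by fact
  obtain T :: "nat set" and R where T: "finite T" and R: "R \<subseteq> lists (T \<times> UNIV)"
      "rec_enum_words (T \<times> UNIV) R" and iso: "G \<cong> presented_group T R"
    using assms(2) unfolding recursively_presented_def by auto
  let ?A = "T \<times> (UNIV :: bool set)"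
  obtain e where e: "inj_on e ?A" and re: "rec_enum_nat (word_code e ` R)"
    using R(2) unfolding rec_enum_words_def by auto
  obtain \<phi> where im: "\<phi> ` lists ?A = carrier G" and Nil: "\<phi> [] = \<one>"
    and \<phi>: "\<forall>u\<in>lists ?A. \<forall>v\<in>lists ?A.
      \<phi> (u @ v) = \<phi> u \<otimes> \<phi> v \<and> (\<phi> u = \<phi> v \<longleftrightarrow> presented_eq T R u v)"
    using presented_group_classes[OF assms(1) iso] by (elim exE conjE)
  have closed: "\<phi> u \<in> carrier G" if "u \<in> lists ?A" for u
    using im that by blast
  have mult: "\<phi> (u @ v) = \<phi> u \<otimes> \<phi> v" and eq: "\<phi> u = \<phi> v \<longleftrightarrow> presented_eq T R u v"
    if "u \<in> lists ?A" "v \<in> lists ?A" for u v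
    using \<phi> that by blast+
  define cancel where "cancel = {[(s, b), (s, \<not> b)] |s b. s \<in> T}"
  define K where "K = e ` ?A"
  define L where "L n = (if n \<in> K then \<phi> [the_inv_into ?A e n] else \<one>)" for n
  define Q where "Q = map e ` (R \<union> cancel)"
  have L_e: "L (e x) = \<phi> [x]" if "x \<in> ?A" for x
    using that the_inv_into_f_f[OF e that] by (simp add: L_def K_def)
  have val: "word_value G (map L (map e u)) = \<phi> u" if "u \<in> lists ?A" for u
    using that
  proof (induction u)
    case (Cons x u)
    then have "\<phi> (x # u) = \<phi> [x] \<otimes> \<phi> u" using mult[of "[x]" u] by simp
    then show ?case using Cons L_e[of x] by (simp add: word_value_def)
  qed (simp add: word_value_def Nil)
  have relators: "r \<in> lists ?A \<and> presented_eq T R r []" if "r \<in> R \<union> cancel" for r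
  proof (cases "r \<in> R")
    case True
    then show ?thesis using R(1) presented_eq.relator by blast
  next
    case False
    then obtain s b where "r = [(s, b), (s, \<not> b)]" "s \<in> T"
      using \<open>r \<in> R \<union> cancel\<close> unfolding cancel_def by blast
    then show ?thesis using presented_eq.cancel by simp
  qed
  have "coded_presentation G L K Q"
  proof (intro coded_presentation.intro coded_presentation_axioms.intro)
    show "L n \<in> carrier G" for n
    proof (cases "n \<in> K")
      case True
      then have "the_inv_into ?A e n \<in> ?A"
        using the_inv_into_into[OF e] unfolding K_def by blast
      then show ?thesis using True closed[of "[the_inv_into ?A e n]"] by (simp add: L_def)
    qed (simp add: L_def)
    show "\<exists>u\<in>lists K. word_value G (map L u) = g" if g: "g \<in> carrier G" for g
    proof -
      have "g \<in> \<phi> ` lists ?A" using g im by simp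
      then obtain u where u: "u \<in> lists ?A" "\<phi> u = g" by (elim imageE) simp
      have "map e u \<in> lists K" using u(1) unfolding K_def lists_image by (rule imageI)
      then show ?thesis using val[OF u(1)] u(2) by blast
    qed
    show "word_value G (map L q) = \<one>" if q: "q \<in> Q" for q
    proof -
      obtain r where r: "q = map e r" "r \<in> R \<union> cancel" using q unfolding Q_def by (rule imageE)
      then have "\<phi> r = \<phi> []" using relators[OF r(2)] eq[of r "[]"] by simp
      then show ?thesis using val[of r] relators[OF r(2)] r(1) Nil by simp
    qed
    show "u \<in> X \<longleftrightarrow> v \<in> X"
      if uv: "u \<in> lists K" "v \<in> lists K" "word_value G (map L u) = word_value G (map L v)"
        and X: "insertion_invariant Q X" for u v X
    proof -
      obtain u' v' where u': "u' \<in> lists ?A" "u = map e u'" and v': "v' \<in> lists ?A" "v = map e v'"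
        using uv(1,2) unfolding K_def lists_image by blast
      have "presented_eq T R u' v'"
        using uv(3) val[OF u'(1)] val[OF v'(1)] eq[OF u'(1) v'(1)] u'(2) v'(2) by simp
      moreover have "insertion_invariant (R \<union> cancel) {w. map e w \<in> X}"
        using X by (simp add: insertion_invariant_def Q_def)
      ultimately show ?thesis
        using presented_eq_imp_insertion_invariant[of T R u' v' "{w. map e w \<in> X}" "[]" "[]"]
        unfolding cancel_def u'(2) v'(2) by simp
    qed
  qed (fact assms(1))
  moreover have "semidecidable_nat (list_encode ` Q)"
  proof -
    have "cancel = (\<lambda>(s, b). [(s, b), (s, \<not> b)]) ` ?A"
      by (auto simp: cancel_def image_iff)
    then have "finite cancel" using T by simp
    moreover have "list_encode ` Q = word_code e ` R \<union> word_code e ` cancel"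
      unfolding Q_def word_code_def by (simp only: image_image image_Un)
    ultimately show ?thesis
      using semidecidable_nat_Un_finite[OF rec_enum_nat_imp_semidecidable[OF re]] by simp
  qed
  ultimately show ?thesis by (rule that)
qed

section \<open>Searching for a refutation\<close>

text \<open>
  The two kinds of conditions on a set \<open>X\<close> of codes of words. \<open>P\<close> is a semidecision procedure for
  the codes of relators or of pattern codings. All numbers that occur are bounded by the stage
  \<open>n\<close>, which makes the search recursive, and so are the codes whose membership in \<open>X\<close> is tested,
  which makes it finitary.
\<close>

definition refutes_invariance :: "(nat \<Rightarrow> nat \<Rightarrow> bool) \<Rightarrow> nat \<Rightarrow> nat set \<Rightarrow> bool" where
  "refutes_invariance P n X \<longleftrightarrow> (\<exists>a<n. \<exists>b<n. \<exists>r<n. \<exists>i<n. P r i \<and>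
     append_code a (append_code r b) < n \<and> append_code a b < n \<and>
     \<not> (append_code a (append_code r b) \<in> X \<longleftrightarrow> append_code a b \<in> X))"

text \<open>If \<open>q\<close> codes an entry \<open>(w, a)\<close> of a pattern coding, this is the place of \<open>w\<close> seen from \<open>g\<close>.\<close>

definition translate_code :: "(nat \<Rightarrow> nat list) \<Rightarrow> nat \<Rightarrow> nat \<Rightarrow> nat" where
  "translate_code t g q = append_code g (substitute_code t (fst (prod_decode q)))"

definition refutes_avoidance ::
    "(nat \<Rightarrow> nat \<Rightarrow> bool) \<Rightarrow> (nat \<Rightarrow> nat list) \<Rightarrow> nat \<Rightarrow> nat \<Rightarrow> nat set \<Rightarrow> bool" where
  "refutes_avoidance P t d n X \<longleftrightarrow> (\<exists>g<n. \<exists>c<n. \<exists>i<n. P c i \<and>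
     (\<forall>q<c. q \<in> set_decode c \<longrightarrow> translate_code t g q < n \<and>
       (translate_code t g q \<in> X \<longleftrightarrow> snd (prod_decode q) = d)))"

lemma finitary_refutes_invariance: "finitary (refutes_invariance P)"
  unfolding finitary_def
proof (intro conjI allI impI)
  fix n :: nat and X Y assume "X \<inter> {..<n} = Y \<inter> {..<n}"
  then have "k \<in> X \<longleftrightarrow> k \<in> Y" if "k < n" for k
    using that by (metis Int_iff lessThan_iff)
  then show "refutes_invariance P n X = refutes_invariance P n Y"
    unfolding refutes_invariance_def by (simp cong: conj_cong)
next
  fix n m :: nat and X assume "n \<le> m" "refutes_invariance P n X"
  then show "refutes_invariance P m X"
    using less_le_trans[of _ n m] unfolding refutes_invariance_def by blast
qed

lemma finitary_refutes_avoidance: "finitary (refutes_avoidance P t d)"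
  unfolding finitary_def
proof (intro conjI allI impI)
  fix n :: nat and X Y assume "X \<inter> {..<n} = Y \<inter> {..<n}"
  then have "k \<in> X \<longleftrightarrow> k \<in> Y" if "k < n" for k
    using that by (metis Int_iff lessThan_iff)
  then show "refutes_avoidance P t d n X = refutes_avoidance P t d n Y"
    unfolding refutes_avoidance_def by (simp cong: conj_cong)
next
  fix n m :: nat and X assume "n \<le> m" "refutes_avoidance P t d n X"
  then show "refutes_avoidance P t d m X"
    using less_le_trans[of _ n m] unfolding refutes_avoidance_def by blast
qed

lemma computable_refutes_invariance:
  assumes P: "computable_pred 2 (\<lambda>xs. P (xs ! 0) (xs ! 1))"
  shows "computable_pred 3 (\<lambda>xs. refutes_invariance P (xs ! 1) (set_decode (xs ! 2)))"
  unfolding refutes_invariance_def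
  by (intro computable_rules computable_pred_comp2[OF P]) simp_all

lemma computable_refutes_avoidance:
  assumes P: "computable_pred 2 (\<lambda>xs. P (xs ! 0) (xs ! 1))"
    and F: "finite F" "\<And>a. a \<notin> F \<Longrightarrow> t a = []"
  shows "computable_pred 3 (\<lambda>xs. refutes_avoidance P t d (xs ! 1) (set_decode (xs ! 2)))"
  unfolding refutes_avoidance_def translate_code_def
  by (intro computable_rules computable_pred_comp2[OF P] computable_substitute_code[OF F]) simp_all

lemma ex_refutes_invariance_iff:
  assumes "list_encode ` Q = {r. \<exists>i. P r i}"
  shows "(\<exists>n. refutes_invariance P n X) \<longleftrightarrow> \<not> insertion_invariant Q {u. list_encode u \<in> X}"
proof -
  have "(\<exists>n. refutes_invariance P n X) \<longleftrightarrow> (\<exists>a b r i. P r i \<and>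
      \<not> (append_code a (append_code r b) \<in> X \<longleftrightarrow> append_code a b \<in> X))" (is "_ \<longleftrightarrow> ?E")
  proof
    assume ?E
    then obtain a b r i where *: "P r i"
        "\<not> (append_code a (append_code r b) \<in> X \<longleftrightarrow> append_code a b \<in> X)" by blast
    (* The stage only has to exceed every number that is looked at. *)
    let ?n = "Suc (a + b + r + i + append_code a (append_code r b) + append_code a b)"
    have "a < ?n" "b < ?n" "r < ?n" "i < ?n" "append_code a (append_code r b) < ?n"
      "append_code a b < ?n" by simp_all
    then have "refutes_invariance P ?n X" using * unfolding refutes_invariance_def by blast
    then show "\<exists>n. refutes_invariance P n X" ..
  qed (unfold refutes_invariance_def, blast)
  also have "\<dots> \<longleftrightarrow> (\<exists>a b. \<exists>r\<in>list_encode ` Q.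
      \<not> (append_code a (append_code r b) \<in> X \<longleftrightarrow> append_code a b \<in> X))"
    unfolding assms by blast
  also have "\<dots> \<longleftrightarrow> (\<exists>q\<in>Q. \<exists>a b. \<not> (list_encode (list_decode a @ q @ list_decode b) \<in> X
      \<longleftrightarrow> list_encode (list_decode a @ list_decode b) \<in> X))"
    by (simp add: append_code_def) blast
  also have "\<dots> \<longleftrightarrow> \<not> insertion_invariant Q {u. list_encode u \<in> X}"
    unfolding insertion_invariant_def mem_Collect_eq by (metis list_encode_inverse)
  finally show ?thesis .
qed

lemma ex_refutes_avoidance_iff:
  assumes P: "coding_code e d ` C = {c. \<exists>i. P c i}"
    and C: "C \<subseteq> pattern_codings S {0, 1}"
    and d: "inj_on d {0, 1 :: nat}"
    and t: "\<And>s. s \<in> S \<Longrightarrow> t (e s) = t' s"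
  shows "(\<exists>n. refutes_avoidance P t (d 1) n X) \<longleftrightarrow>
    (\<exists>g. \<exists>c\<in>C. \<forall>(w, a)\<in>c. g @ concat (map t' w) \<in> {u. list_encode u \<in> X} \<longleftrightarrow> a = 1)"
proof -
  let ?ok = "\<lambda>g q. translate_code t g q \<in> X \<longleftrightarrow> snd (prod_decode q) = d 1"
  have surj: "(\<exists>g. F (list_decode g)) \<longleftrightarrow> (\<exists>u. F u)" for F
    by (metis list_encode_inverse)
  have lt: "q < c" if "q \<in> set_decode c" for q c
  proof -
    have "2 ^ q \<le> c"
      using that by (metis div_less even_zero linorder_not_less mem_Collect_eq set_decode_def)
    then show ?thesis by (meson less_exp order.strict_trans2)
  qed
  have "(\<exists>n. refutes_avoidance P t (d 1) n X) \<longleftrightarrow>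
      (\<exists>g. \<exists>c\<in>coding_code e d ` C. \<forall>q\<in>set_decode c. ?ok g q)" (is "_ \<longleftrightarrow> ?E")
  proof
    assume ?E
    then obtain g c i where *: "P c i" "\<forall>q\<in>set_decode c. ?ok g q"
      unfolding P by blast
    let ?n = "Suc (g + c + i + (\<Sum>q<c. translate_code t g q))"
    have "translate_code t g q < ?n" if "q < c" for q
      using member_le_sum[of q "{..<c}" "translate_code t g"] that by simp
    moreover have "g < ?n" "c < ?n" "i < ?n" by simp_all
    ultimately have "refutes_avoidance P t (d 1) ?n X"
      using * unfolding refutes_avoidance_def by blast
    then show "\<exists>n. refutes_avoidance P t (d 1) n X" ..
  next
    assume "\<exists>n. refutes_avoidance P t (d 1) n X"
    then show ?E
      unfolding refutes_avoidance_def P using lt by blast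
  qed
  also have "\<dots> \<longleftrightarrow> (\<exists>g. \<exists>c\<in>C. \<forall>q\<in>set_decode (coding_code e d c). ?ok g q)"
    by simp
  also have "\<dots> \<longleftrightarrow> (\<exists>g. \<exists>c\<in>C. \<forall>(w, a)\<in>c.
      list_decode g @ concat (map t' w) \<in> {u. list_encode u \<in> X} \<longleftrightarrow> a = 1)"
  proof (rule ex_cong1, rule bex_cong, rule HOL.refl)
    fix g c assume c: "c \<in> C"
    then have fin: "finite c" and sub: "c \<subseteq> lists S \<times> {0, 1}"
      using C unfolding pattern_codings_def by auto
    have "set_decode (coding_code e d c) = (\<lambda>(w, a). prod_encode (word_code e w, d a)) ` c"
      unfolding coding_code_def using fin by (simp add: set_encode_inverse)
    moreover have "?ok g (prod_encode (word_code e w, d a)) \<longleftrightarrow>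
        (list_decode g @ concat (map t' w) \<in> {u. list_encode u \<in> X} \<longleftrightarrow> a = 1)"
      if "(w, a) \<in> c" for w a
    proof -
      have w: "w \<in> lists S" and a: "a \<in> {0, 1}" using sub that by auto
      have "map t (map e w) = map t' w" using w t by (auto simp: in_lists_conv_set)
      moreover have "d a = d 1 \<longleftrightarrow> a = 1" using a d by (auto simp: inj_on_def)
      ultimately show ?thesis
        unfolding translate_code_def append_code_def substitute_code_def word_code_def
        by (simp only: prod_encode_inverse fst_conv snd_conv list_encode_inverse mem_Collect_eq)
    qed
    ultimately show "(\<forall>q\<in>set_decode (coding_code e d c). ?ok g q) \<longleftrightarrow> (\<forall>(w, a)\<in>c.
        list_decode g @ concat (map t' w) \<in> {u. list_encode u \<in> X} \<longleftrightarrow> a = 1)"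
      by fastforce
  qed
  also have "\<dots> \<longleftrightarrow> (\<exists>g. \<exists>c\<in>C. \<forall>(w, a)\<in>c.
      g @ concat (map t' w) \<in> {u. list_encode u \<in> X} \<longleftrightarrow> a = 1)"
    using surj[of "\<lambda>u. \<exists>c\<in>C. \<forall>(w, a)\<in>c. u @ concat (map t' w) \<in> {u. list_encode u \<in> X} \<longleftrightarrow> a = 1"]
    by simp
  finally show ?thesis .
qed

section \<open>The word problem and configurations with at most one 1\<close>

lemma all_word_sets_iff:
  "(\<forall>X. F X) \<longleftrightarrow> (\<forall>Z. F {u. list_encode u \<in> Z})"
proof
  assume F: "\<forall>Z. F {u. list_encode u \<in> Z}"
  show "\<forall>X. F X"
  proof
    fix X
    have "{u. list_encode u \<in> list_encode ` X} = X"
      by (simp add: inj_image_mem_iff[OF inj_list_encode])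
    then show "F X" using F by metis
  qed
qed simp

context coded_presentation
begin

text \<open>
  The search for a refutation of all invariant sets that contain \<open>[]\<close>, whose code is \<open>0\<close>, but not
  the word whose code is \<open>?p k\<close>.
\<close>

lemma semidecidable_trivial:
  assumes Q: "semidecidable_nat (list_encode ` Q)"
    and F: "finite F" "\<And>a. a \<notin> F \<Longrightarrow> t a = []" and t: "\<And>a. t a \<in> lists K"
  shows "semidecidable_nat {k. val (concat (map t (list_decode k))) = \<one>}"
proof -
  obtain P where P: "computable_pred 2 (\<lambda>xs. P (xs ! 0) (xs ! 1))"
      "list_encode ` Q = {r. \<exists>i. P r i}"
    using Q unfolding semidecidable_nat_def by blast
  let ?p = "substitute_code t"
  define M where "M k n X \<longleftrightarrow> refutes_invariance P n X \<or>
    (0 < n \<and> 0 \<notin> X) \<or> (?p k < n \<and> ?p k \<in> X)" for k n X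
  have "finitary (M k)" for k
    unfolding M_def
    by (intro finitary_disj finitary_refutes_invariance finitary_mem finitary_not_mem)
  moreover have "computable_pred 3 (\<lambda>xs. M (xs ! 0) (xs ! 1) (set_decode (xs ! 2)))"
    unfolding M_def
    by (intro computable_rules computable_refutes_invariance P(1) computable_substitute_code[OF F])
       simp_all
  ultimately have "semidecidable_nat {k. \<forall>X. \<exists>n. M k n X}"
    by (rule semidecidable_refutable)
  moreover have "val (concat (map t (list_decode k))) = \<one> \<longleftrightarrow> (\<forall>X. \<exists>n. M k n X)" for k
  proof -
    have "concat (map t (list_decode k)) \<in> lists K"
      using concat_map_in_lists[of _ UNIV t] t by simp
    then have "val (concat (map t (list_decode k))) = \<one> \<longleftrightarrow>
        (\<forall>X. insertion_invariant Q X \<and> [] \<in> X \<longrightarrow> concat (map t (list_decode k)) \<in> X)"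
      by (rule trivial_iff)
    also have "\<dots> \<longleftrightarrow> (\<forall>Z. insertion_invariant Q {u. list_encode u \<in> Z} \<and> [] \<in> {u. list_encode u \<in> Z}
        \<longrightarrow> concat (map t (list_decode k)) \<in> {u. list_encode u \<in> Z})"
      by (rule all_word_sets_iff)
    finally have "val (concat (map t (list_decode k))) = \<one> \<longleftrightarrow>
        (\<forall>Z. insertion_invariant Q {u. list_encode u \<in> Z} \<and> 0 \<in> Z \<longrightarrow> ?p k \<in> Z)"
      by (simp add: substitute_code_def)
    moreover have "(\<exists>n. M k n Z) \<longleftrightarrow>
        (insertion_invariant Q {u. list_encode u \<in> Z} \<and> 0 \<in> Z \<longrightarrow> ?p k \<in> Z)" for Z
      using ex_refutes_invariance_iff[OF P(2), of Z] unfolding M_def by blast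
    ultimately show ?thesis by (simp only:)
  qed
  ultimately show ?thesis by simp
qed

text \<open>
  The same search with the roles exchanged: now the word has to be an element, and the sets also
  have to avoid the codings. Only the letter \<open>d 1\<close> matters, as every other letter of a coding
  is \<open>0\<close>.
\<close>

lemma semidecidable_nontrivial:
  assumes Q: "semidecidable_nat (list_encode ` Q)"
    and S: "S \<subseteq> carrier G"
    and C: "C \<subseteq> pattern_codings S {0, 1}" "at_most_one_one G = avoiding G {0, 1} C"
    and d: "inj_on d {0, 1}" and re: "rec_enum_nat (coding_code e d ` C)"
    and F: "finite F" "\<And>a. a \<notin> F \<Longrightarrow> t a = []" and t: "\<And>a. t a \<in> lists K"
    and te: "\<And>s. s \<in> S \<Longrightarrow> val (t (e s)) = s"
  shows "semidecidable_nat {k. val (concat (map t (list_decode k))) \<noteq> \<one>}"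
proof -
  obtain P where P: "computable_pred 2 (\<lambda>xs. P (xs ! 0) (xs ! 1))"
      "list_encode ` Q = {r. \<exists>i. P r i}"
    using Q unfolding semidecidable_nat_def by blast
  obtain P' where P': "computable_pred 2 (\<lambda>xs. P' (xs ! 0) (xs ! 1))"
      "coding_code e d ` C = {r. \<exists>i. P' r i}"
    using rec_enum_nat_imp_semidecidable[OF re] unfolding semidecidable_nat_def by blast
  let ?p = "substitute_code t"
  define M where "M k n X \<longleftrightarrow> (refutes_invariance P n X \<or> refutes_avoidance P' t (d 1) n X) \<or>
    (0 < n \<and> 0 \<notin> X) \<or> (?p k < n \<and> ?p k \<notin> X)" for k n X
  have "finitary (M k)" for k
    unfolding M_def
    by (intro finitary_disj finitary_refutes_invariance finitary_refutes_avoidance finitary_not_mem)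
  moreover have "computable_pred 3 (\<lambda>xs. M (xs ! 0) (xs ! 1) (set_decode (xs ! 2)))"
    unfolding M_def
    by (intro computable_rules computable_refutes_invariance P(1)
        computable_refutes_avoidance[OF P'(1) F] computable_substitute_code[OF F]) simp_all
  ultimately have "semidecidable_nat {k. \<forall>X. \<exists>n. M k n X}"
    by (rule semidecidable_refutable)
  moreover have "val (concat (map t (list_decode k))) \<noteq> \<one> \<longleftrightarrow> (\<forall>X. \<exists>n. M k n X)" for k
  proof -
    let ?B = "\<lambda>X. \<exists>g. \<exists>c\<in>C. \<forall>(w, a)\<in>c. g @ concat (map (\<lambda>s. t (e s)) w) \<in> X \<longleftrightarrow> a = 1"
    have "concat (map t (list_decode k)) \<in> lists K"
      using concat_map_in_lists[of _ UNIV t] t by simp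
    then have "val (concat (map t (list_decode k))) \<noteq> \<one> \<longleftrightarrow>
        (\<forall>X. insertion_invariant Q X \<and> [] \<in> X \<and> concat (map t (list_decode k)) \<in> X \<longrightarrow> ?B X)"
      by (rule nontrivial_iff[OF _ S C]) (simp_all only: t te)
    also have "\<dots> \<longleftrightarrow> (\<forall>Z. insertion_invariant Q {u. list_encode u \<in> Z} \<and> [] \<in> {u. list_encode u \<in> Z}
        \<and> concat (map t (list_decode k)) \<in> {u. list_encode u \<in> Z} \<longrightarrow> ?B {u. list_encode u \<in> Z})"
      by (rule all_word_sets_iff)
    also have "\<dots> \<longleftrightarrow> (\<forall>Z. insertion_invariant Q {u. list_encode u \<in> Z} \<and> 0 \<in> Z \<and> ?p k \<in> Z
        \<longrightarrow> ?B {u. list_encode u \<in> Z})"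
      unfolding mem_Collect_eq substitute_code_def list_encode.simps ..
    finally have 1: "val (concat (map t (list_decode k))) \<noteq> \<one> \<longleftrightarrow> \<dots>" .
    have 2: "(\<exists>n. M k n Z) \<longleftrightarrow> \<not> (insertion_invariant Q {u. list_encode u \<in> Z} \<and> 0 \<in> Z \<and> ?p k \<in> Z)
        \<or> ?B {u. list_encode u \<in> Z}" for Z
    proof -
      have "(\<exists>n. M k n Z) \<longleftrightarrow> (\<exists>n. refutes_invariance P n Z) \<or> (\<exists>n. refutes_avoidance P' t (d 1) n Z)
          \<or> 0 \<notin> Z \<or> ?p k \<notin> Z"
        unfolding M_def by blast
      then show ?thesis
        unfolding ex_refutes_invariance_iff[OF P(2)]
          ex_refutes_avoidance_iff[OF P'(2) C(1) d HOL.refl]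
        by argo
    qed
    show ?thesis unfolding 1 2 by (simp only: imp_conv_disj)
  qed
  ultimately show ?thesis by simp
qed

end

lemma mem_word_code_image_lists:
  "k \<in> word_code e ` lists S \<longleftrightarrow> list_decode k \<in> lists (e ` S)"
proof -
  have "k \<in> word_code e ` lists S \<longleftrightarrow> (\<exists>w\<in>lists S. list_decode k = map e w)"
    unfolding word_code_def image_iff by (metis list_decode_inverse list_encode_inverse)
  then show ?thesis by (simp only: lists_image image_iff)
qed

text \<open>
  The letters of \<open>S\<close> are numbered as in the enumeration of the codings and translated by \<open>t\<close> into
  words over the generators of the presentation. Whether the translation is trivial is
  semidecidable both ways; it remains to recognise the codes of words over \<open>S\<close>.
\<close>

lemma decidable_word_problem_if_effectively_closed:
  fixes G (structure)
  assumes "group G" "finite S" and S: "S \<subseteq> carrier G"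
    and "recursively_presented G"
    and closed: "effectively_closed G S {0, 1} (at_most_one_one G)"
  shows "decidable_words S (word_problem G S)"
proof -
  interpret group G by fact
  obtain C e d where C: "C \<subseteq> pattern_codings S {0, 1}" "at_most_one_one G = avoiding G {0, 1} C"
    and e: "inj_on e S" and d: "inj_on d {0, 1}" and re: "rec_enum_nat (coding_code e d ` C)"
    using closed unfolding effectively_closed_def rec_enum_codings_def by blast
  obtain L K Q where LKQ: "coded_presentation G L K Q" and Q: "semidecidable_nat (list_encode ` Q)"
    by (rule recursively_presented_imp_coded_presentation[OF assms(1,4)])
  interpret coded_presentation G L K Q by (fact LKQ)
  have "\<forall>s\<in>S. \<exists>u\<in>lists K. val u = s"
    using represents S unfolding val_def by blast
  then obtain t' where t': "\<And>s. s \<in> S \<Longrightarrow> t' s \<in> lists K \<and> val (t' s) = s"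
    by metis
  define t where "t n = (if n \<in> e ` S then t' (the_inv_into S e n) else [])" for n
  have te: "t (e s) = t' s" if "s \<in> S" for s
    using that by (simp add: t_def the_inv_into_f_f[OF e])
  have val_t: "val (t (e s)) = s" if s: "s \<in> S" for s
    using te[OF s] t'[OF s] by simp
  have tK: "t n \<in> lists K" for n
  proof (cases "n \<in> e ` S")
    case True
    then obtain s where "n = e s" "s \<in> S" by (rule imageE)
    then show ?thesis using t'[of s] te[of s] by simp
  qed (simp add: t_def)
  have finite: "finite (e ` S)" and outside: "n \<notin> e ` S \<Longrightarrow> t n = []" for n
    using assms(2) by (auto simp: t_def)
  let ?A = "{k. val (concat (map t (list_decode k))) = \<one>}"
  have "semidecidable_nat ?A"
    by (rule semidecidable_trivial[OF Q finite outside tK])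
  moreover have "semidecidable_nat (- ?A)"
  proof -
    have "semidecidable_nat {k. val (concat (map t (list_decode k))) \<noteq> \<one>}"
      by (rule semidecidable_nontrivial[OF Q S C d re finite outside tK val_t])
    then show ?thesis by (simp only: Collect_neg_eq)
  qed
  ultimately have A: "computable_pred 1 (\<lambda>xs. xs ! 0 \<in> ?A)"
    using decidable_nat_if_semidecidable decidable_nat_iff by blast
  have "computable_pred 1 (\<lambda>xs. list_decode (xs ! 0) \<in> lists (e ` S) \<and> xs ! 0 \<in> ?A)"
    by (intro computable_pred_conj A computable_pred_word_over finite computable_nth) simp
  moreover have "k \<in> word_code e ` word_problem G S \<longleftrightarrow>
      list_decode k \<in> lists (e ` S) \<and> k \<in> ?A" for k
  proof -
    have wp: "word_code e w \<in> ?A \<longleftrightarrow> word_value G w = \<one>" if w: "w \<in> lists S" for w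
    proof -
      have "map t (map e w) = map t' w" using w te by (auto simp: in_lists_conv_set)
      then show ?thesis
        using val_concat_map[OF w, of t'] t' by (simp add: word_code_def del: map_map)
    qed
    show ?thesis
    proof
      assume "k \<in> word_code e ` word_problem G S"
      then obtain w where w: "k = word_code e w" "w \<in> lists S" "word_value G w = \<one>"
        unfolding word_problem_def by blast
      moreover have "list_decode k \<in> lists (e ` S)"
        using w(1,2) by (auto simp: word_code_def)
      ultimately show "list_decode k \<in> lists (e ` S) \<and> k \<in> ?A" using wp by blast
    next
      assume k: "list_decode k \<in> lists (e ` S) \<and> k \<in> ?A"
      then obtain w where w: "k = word_code e w" "w \<in> lists S"
        using mem_word_code_image_lists[of k e S] by blast
      then show "k \<in> word_code e ` word_problem G S"
        using k w(2) wp[OF w(2)] unfolding word_problem_def by blast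
    qed
  qed
  ultimately have "decidable_nat (word_code e ` word_problem G S)"
    unfolding decidable_nat_iff by (simp only:)
  then show ?thesis unfolding decidable_words_def using e by blast
qed

text \<open>
  Two distinct elements \<open>g\<close> and \<open>h\<close> differ by a word \<open>w\<close> for \<open>inv g \<otimes> h\<close>, which is nontrivial, so
  the codings \<open>pair w\<close> rule out every second \<open>1\<close>, and nothing else.
\<close>

lemma effectively_closed_if_decidable_word_problem:
  fixes G (structure)
  assumes "group G" "finite S" and S: "symmetric_generating_set G S"
    and decidable: "decidable_words S (word_problem G S)"
  shows "effectively_closed G S {0, 1} (at_most_one_one G)"
proof -
  interpret group G by fact
  have sub: "S \<subseteq> carrier G" and gen: "\<And>g. g \<in> carrier G \<Longrightarrow> \<exists>w\<in>lists S. word_value G w = g"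
    using S generate_imp_word_value[of S] unfolding symmetric_generating_set_def by auto
  obtain e where e: "inj_on e S" and D: "decidable_nat (word_code e ` word_problem G S)"
    using decidable unfolding decidable_words_def by blast
  define N where "N = lists S - word_problem G S"
  define pair where "pair w = {([], 1 :: nat), (w, 1)}" for w :: "'a list"
  define code :: "nat \<Rightarrow> nat"
    where "code n = 2 ^ prod_encode (0, 1) + 2 ^ prod_encode (n, 1)" for n
  have inj_code: "inj_on (word_code e) (lists S)"
  proof -
    have "inj_on (list_encode \<circ> map e) (lists S)"
      using inj_on_map_lists[OF e] inj_list_encode by (blast intro: comp_inj_on)
    then show ?thesis by (simp add: word_code_def[abs_def] comp_def)
  qed
  have code: "coding_code e id (pair w) = code (word_code e w)" if "w \<in> N" for w
  proof -
    (* As w is nontrivial, pair w has two distinct entries, and the code of the set is a sum. *)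
    have "w \<noteq> []" using that by (auto simp: N_def word_problem_def word_value_def)
    then have "word_code e w \<noteq> 0"
      by (cases w) (simp_all add: word_code_def)
    then have "prod_encode (word_code e w, 1) \<noteq> prod_encode (0, 1)"
      by simp
    then show ?thesis
      by (simp add: pair_def coding_code_def code_def set_encode_def word_code_def)
  qed
  have "computable_pred 1 (\<lambda>xs. list_decode (xs ! 0) \<in> lists (e ` S) \<and>
      \<not> xs ! 0 \<in> word_code e ` word_problem G S)"
    using assms(2) D unfolding decidable_nat_iff
    by (intro computable_pred_conj computable_pred_not computable_pred_word_over computable_nth) simp_all
  moreover have "computable 1 (\<lambda>xs. code (xs ! 0))"
    unfolding code_def by (intro computable_rules) simp
  ultimately have "rec_enum_nat (code ` {k. list_decode k \<in> lists (e ` S) \<and>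
      \<not> k \<in> word_code e ` word_problem G S})"
    by (rule rec_enum_nat_image)
  moreover have "{k. list_decode k \<in> lists (e ` S) \<and> \<not> k \<in> word_code e ` word_problem G S}
      = word_code e ` N"
  proof -
    have "{k. list_decode k \<in> lists (e ` S)} = word_code e ` lists S"
      by (simp only: flip: mem_word_code_image_lists) simp
    moreover have "word_code e ` N = word_code e ` lists S - word_code e ` word_problem G S"
      unfolding N_def by (rule inj_on_image_set_diff[OF inj_code]) (auto simp: word_problem_def)
    ultimately show ?thesis by blast
  qed
  moreover have "code ` word_code e ` N = coding_code e id ` pair ` N"
    using code by (simp add: image_image)
  ultimately have re: "rec_enum_codings S {0, 1} (pair ` N)"
    unfolding rec_enum_codings_def using e by (intro exI[of _ e] exI[of _ id]) simp
  have codings: "pair ` N \<subseteq> pattern_codings S {0, 1}"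
    by (auto simp: pattern_codings_def pair_def N_def)
  have "x \<in> at_most_one_one G \<longleftrightarrow> x \<in> avoiding G {0, 1} (pair ` N)" for x
  proof -
    have "(\<forall>g\<in>carrier G. \<forall>h\<in>carrier G. x g = 1 \<and> x h = 1 \<longrightarrow> g = h) \<longleftrightarrow>
        \<not> (\<exists>g\<in>carrier G. \<exists>w\<in>N. x g = 1 \<and> x (g \<otimes> word_value G w) = 1)"
    proof
      assume one: "\<forall>g\<in>carrier G. \<forall>h\<in>carrier G. x g = 1 \<and> x h = 1 \<longrightarrow> g = h"
      show "\<not> (\<exists>g\<in>carrier G. \<exists>w\<in>N. x g = 1 \<and> x (g \<otimes> word_value G w) = 1)"
      proof (intro notI, elim bexE conjE)
        fix g w assume gw: "g \<in> carrier G" "w \<in> N" "x g = 1" "x (g \<otimes> word_value G w) = 1"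
        have w: "word_value G w \<in> carrier G" "word_value G w \<noteq> \<one>"
          using gw(2) sub word_value_closed[of w] by (auto simp: N_def word_problem_def)
        then have "g = g \<otimes> word_value G w"
          using one gw by (metis m_closed)
        then show False using w gw(1) by simp
      qed
    next
      assume none: "\<not> (\<exists>g\<in>carrier G. \<exists>w\<in>N. x g = 1 \<and> x (g \<otimes> word_value G w) = 1)"
      show "\<forall>g\<in>carrier G. \<forall>h\<in>carrier G. x g = 1 \<and> x h = 1 \<longrightarrow> g = h"
      proof (intro ballI impI, elim conjE, rule ccontr)
        fix g h assume gh: "g \<in> carrier G" "h \<in> carrier G" "x g = 1" "x h = 1" "g \<noteq> h"
        obtain w where w: "w \<in> lists S" "word_value G w = inv g \<otimes> h"
          using gen[of "inv g \<otimes> h"] gh by auto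
        have h: "g \<otimes> word_value G w = h"
          using w(2) gh by (simp add: m_assoc[symmetric])
        then have "w \<in> N"
          using w(1) gh by (auto simp: N_def word_problem_def)
        then show False using none gh h by metis
      qed
    qed
    moreover have "(\<forall>(v, a)\<in>pair w. x (g \<otimes> word_value G v) = a) \<longleftrightarrow>
        x g = 1 \<and> x (g \<otimes> word_value G w) = 1" if "g \<in> carrier G" for g w
      using that by (simp add: pair_def word_value_def)
    ultimately show ?thesis
      by (simp add: at_most_one_one_def avoiding_iff)
  qed
  then have "at_most_one_one G = avoiding G {0, 1} (pair ` N)" by blast
  then show ?thesis
    unfolding effectively_closed_def using re codings by blast
qed

theorem proposition2p11:
  fixes G :: "('a, 'm) monoid_scheme" and S :: "'a set"
  assumes "group G"
    and "finite S" and "symmetric_generating_set G S"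
    and "recursively_presented G"
  shows "effectively_closed G S {0, 1} (at_most_one_one G) \<longleftrightarrow>
         decidable_words S (word_problem G S)"
proof
  have "S \<subseteq> carrier G"
    using assms(3) by (simp add: symmetric_generating_set_def)
  then show "effectively_closed G S {0, 1} (at_most_one_one G) \<Longrightarrow>
      decidable_words S (word_problem G S)"
    using decidable_word_problem_if_effectively_closed[OF assms(1,2) _ assms(4)] by blast
  show "decidable_words S (word_problem G S) \<Longrightarrow>
      effectively_closed G S {0, 1} (at_most_one_one G)"
    by (rule effectively_closed_if_decidable_word_problem[OF assms(1-3)])
qed

end
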